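(* Let $k\ge 2$ be an integer. For every $0 \leq \delta < \varepsilon \leq 1$, there is a polynomial-time reduction from any $(\delta, \varepsilon)$-Gap-$k$-SAT instance with $n$ variables to an instance of $\gamma$-$\mathrm{CVP}_1$ of rank $n$, where \[ \gamma := \frac{\delta \cdot (k - 1) + (1 - \delta) \cdot (k + 1)}{\varepsilon \cdot (k - 1) + (1 - \varepsilon) \cdot (k + 1)} > 1. \]
   Context: A $k$-SAT formula is a conjunction of clauses, each a disjunction of $k$ literals; $\mathrm{val}(\Phi)$ is the maximum over assignments of the fraction of clauses satisfied. $(\delta,\varepsilon)$-Gap-$k$-SAT: distinguish YES instances with $\mathrm{val}(\Phi)\ge\varepsilon$ from NO instances with $\mathrm{val}(\Phi)<\delta$. A lattice of rank $n$ is $\mathcal{L}(B)=\{B\vec z:\vec z\in\mathbb{Z}^n\}$ for $B\in\mathbb{R}^{d\times n}$ with linearly independent columns. $\gamma$-$\mathrm{CVP}_1$: given $B$, $\vec t$ and $r>0$, distinguish $\mathrm{dist}_1(\mathcal{L}(B),\vec t)\le r$ from $\mathrm{dist}_1(\mathcal{L}(B),\vec t)>\gamma r$, where $\mathrm{dist}_1(\mathcal{L},\vec t)=\min_{\vec x\in\mathcal{L}}\|\vec x-\vec t\|_1$ and $\|\vec x\|_1=\sum_i|x_i|$. *)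

theory Defs
  imports Complex_Main "Jordan_Normal_Form.VS_Connect"
begin

section \<open>Deterministic multitape Turing machines and polynomial time\<close>

datatype sym = Blank | Zero | One | Slash | Comma | Semicolon | Hash

datatype dir = To_Left | Stay | To_Right

fun offset :: "dir \<Rightarrow> int" where
  "offset To_Left = - 1"
| "offset Stay = 0"
| "offset To_Right = 1"

text \<open>A tape is a two-way infinite sequence of cells together with a head position.\<close>

type_synonym tape = "(int \<Rightarrow> sym) \<times> int"

definition read :: "tape \<Rightarrow> sym" where
  "read t = fst t (snd t)"

definition act :: "sym \<times> dir \<Rightarrow> tape \<Rightarrow> tape" where
  "act a t = ((fst t)(snd t := fst a), snd t + offset (snd a))"

definition contents :: "sym list \<Rightarrow> int \<Rightarrow> sym" where
  "contents w i = (if 0 \<le> i \<and> i < int (length w) then w ! nat i else Blank)"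

text \<open>The control states of \<open>M\<close> are the numbers up to and including \<open>states M\<close>; the
  initial state is \<open>0\<close> and the unique halting state is \<open>states M\<close>. The alphabet is fixed,
  the number of tapes is not. Tape \<open>0\<close> holds the input and tape \<open>1\<close> the output.\<close>

record tm =
  tapes :: nat
  states :: nat
  trans :: "nat \<Rightarrow> sym list \<Rightarrow> nat \<times> (sym \<times> dir) list"

definition wf_tm :: "tm \<Rightarrow> bool" where
  "wf_tm M \<longleftrightarrow> 2 \<le> tapes M \<and>
     (\<forall>q < states M. \<forall>xs. length xs = tapes M \<longrightarrow>
        fst (trans M q xs) \<le> states M \<and> length (snd (trans M q xs)) = tapes M)"

type_synonym config = "nat \<times> tape list"

definition step :: "tm \<Rightarrow> config \<Rightarrow> config" where
  "step M c = (case c of (q, ts) \<Rightarrow>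
     if q < states M
     then (case trans M q (map read ts) of (q', as) \<Rightarrow> (q', map2 act as ts))
     else (q, ts))"

definition init_config :: "tm \<Rightarrow> sym list \<Rightarrow> config" where
  "init_config M w = (0, (contents w, 0) # replicate (tapes M - 1) (contents [], 0))"

definition outputs_within :: "tm \<Rightarrow> sym list \<Rightarrow> nat \<Rightarrow> sym list \<Rightarrow> bool" where
  "outputs_within M w T v \<longleftrightarrow>
     (case (step M ^^ T) (init_config M w) of (q, ts) \<Rightarrow>
        q = states M \<and> fst (ts ! 1) = contents v)"

text \<open>\<open>f\<close> is computable in polynomial time on the set \<open>D\<close> of problem instances, with respect to
  the given encodings of its arguments and values as strings.\<close>

definition poly_time_on ::
    "'a set \<Rightarrow> ('a \<Rightarrow> sym list) \<Rightarrow> ('b \<Rightarrow> sym list) \<Rightarrow> ('a \<Rightarrow> 'b) \<Rightarrow> bool" where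
  "poly_time_on D enc enc' f \<longleftrightarrow>
     (\<exists>M c e. wf_tm M \<and>
        (\<forall>x\<in>D. outputs_within M (enc x) (c * length (enc x) ^ e + c) (enc' (f x))))"


section \<open>Gap-k-SAT\<close>

text \<open>The literal \<open>(i, True)\<close> is the variable \<open>i\<close>, and \<open>(i, False)\<close> its negation. A formula is
  a number \<open>n\<close> of variables (the variables being \<open>0, ..., n - 1\<close>, not all of which need to occur)
  together with its clauses. Clauses and literals may be repeated. There is at least one clause,
  so that the fraction of satisfied clauses makes sense.\<close>

type_synonym literal = "nat \<times> bool"
type_synonym clause = "literal list"
type_synonym formula = "nat \<times> clause list"

definition num_vars :: "formula \<Rightarrow> nat" where
  "num_vars \<Phi> = fst \<Phi>"

definition ksat_formulas :: "nat \<Rightarrow> formula set" where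
  "ksat_formulas k = {(n, cs). cs \<noteq> [] \<and>
     (\<forall>c\<in>set cs. length c = k \<and> (\<forall>(i, b)\<in>set c. i < n))}"

definition sat_clause :: "(nat \<Rightarrow> bool) \<Rightarrow> clause \<Rightarrow> bool" where
  "sat_clause a c \<longleftrightarrow> (\<exists>(i, b)\<in>set c. a i = b)"

definition val :: "formula \<Rightarrow> real" where
  "val \<Phi> = Max (range (\<lambda>a.
     real (length (filter (sat_clause a) (snd \<Phi>))) / real (length (snd \<Phi>))))"

definition gap_ksat_yes :: "nat \<Rightarrow> real \<Rightarrow> formula set" where
  "gap_ksat_yes k \<epsilon> = {\<Phi> \<in> ksat_formulas k. val \<Phi> \<ge> \<epsilon>}"

definition gap_ksat_no :: "nat \<Rightarrow> real \<Rightarrow> formula set" where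
  "gap_ksat_no k \<delta> = {\<Phi> \<in> ksat_formulas k. val \<Phi> < \<delta>}"


section \<open>The closest vector problem in the 1-norm\<close>

definition l1_norm :: "real vec \<Rightarrow> real" where
  "l1_norm x = (\<Sum>i<dim_vec x. \<bar>x $ i\<bar>)"

definition lattice :: "real mat \<Rightarrow> real vec set" where
  "lattice B = {B *\<^sub>v map_vec of_int z | z :: int vec. z \<in> carrier_vec (dim_col B)}"

text \<open>The infimum is a minimum when the columns of the basis are linearly independent.\<close>

definition dist1 :: "real vec set \<Rightarrow> real vec \<Rightarrow> real" where
  "dist1 L t = (INF x\<in>L. l1_norm (x - t))"

definition lin_indpt_cols :: "real mat \<Rightarrow> bool" where
  "lin_indpt_cols B \<longleftrightarrow> distinct (cols B) \<and>
     module.lin_indpt class_ring (module_vec TYPE(real) (dim_row B)) (set (cols B))"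

type_synonym cvp_instance = "real mat \<times> real vec \<times> real"

definition cvp_instances :: "nat \<Rightarrow> cvp_instance set" where
  "cvp_instances n = {(B, t, r). dim_col B = n \<and> lin_indpt_cols B \<and>
     t \<in> carrier_vec (dim_row B) \<and> r > 0}"

definition cvp1_yes :: "cvp_instance set" where
  "cvp1_yes = {(B, t, r). (\<exists>n. (B, t, r) \<in> cvp_instances n) \<and> dist1 (lattice B) t \<le> r}"

definition cvp1_no :: "real \<Rightarrow> cvp_instance set" where
  "cvp1_no \<gamma> = {(B, t, r). (\<exists>n. (B, t, r) \<in> cvp_instances n) \<and> dist1 (lattice B) t > \<gamma> * r}"


section \<open>Finite descriptions and encodings of instances\<close>

text \<open>Numbers in a CVP instance are described by fractions of integers. If one of the parameters
  \<open>\<delta>\<close>, \<open>\<epsilon>\<close> is irrational (and these may be arbitrary reals, not even computable ones), rational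
  numbers do not suffice to write down a radius such as \<open>m * (\<epsilon> * (k - 1) + (1 - \<epsilon>) * (k + 1))\<close>;
  then a number is described by the coefficients of a rational linear combination of
  \<open>1\<close>, \<open>\<delta>\<close>, \<open>\<epsilon>\<close>.\<close>

definition generators :: "real \<Rightarrow> real \<Rightarrow> real list" where
  "generators \<delta> \<epsilon> = (if \<delta> \<in> \<rat> \<and> \<epsilon> \<in> \<rat> then [1] else [1, \<delta>, \<epsilon>])"

text \<open>The list of numerators and denominators of the coefficients.\<close>

type_synonym num_desc = "(int \<times> nat) list"

definition wf_num :: "real list \<Rightarrow> num_desc \<Rightarrow> bool" where
  "wf_num gs x \<longleftrightarrow> length x = length gs \<and> (\<forall>(p, q)\<in>set x. q > 0)"

definition num_val :: "real list \<Rightarrow> num_desc \<Rightarrow> real" where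
  "num_val gs x = (\<Sum>i<length gs. of_int (fst (x ! i)) / of_nat (snd (x ! i)) * gs ! i)"

text \<open>The number of columns, the rows of the basis matrix, the target, and the radius.\<close>

type_synonym cvp_desc = "nat \<times> num_desc list list \<times> num_desc list \<times> num_desc"

definition wf_cvp_desc :: "real list \<Rightarrow> cvp_desc \<Rightarrow> bool" where
  "wf_cvp_desc gs D = (case D of (n, R, t, r) \<Rightarrow>
     (\<forall>row\<in>set R. length row = n \<and> (\<forall>x\<in>set row. wf_num gs x)) \<and>
     length t = length R \<and> (\<forall>x\<in>set t. wf_num gs x) \<and> wf_num gs r)"

definition cvp_of :: "real list \<Rightarrow> cvp_desc \<Rightarrow> cvp_instance" where
  "cvp_of gs D = (case D of (n, R, t, r) \<Rightarrow>
     (mat (length R) n (\<lambda>(i, j). num_val gs (R ! i ! j)),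
      vec (length R) (\<lambda>i. num_val gs (t ! i)),
      num_val gs r))"

text \<open>Numbers are written in binary, least significant bit first, without leading zeros.\<close>

fun enc_nat :: "nat \<Rightarrow> sym list" where
  "enc_nat n = (if n = 0 then [] else (if odd n then One else Zero) # enc_nat (n div 2))"

declare enc_nat.simps [simp del]

definition enc_int :: "int \<Rightarrow> sym list" where
  "enc_int i = (if i < 0 then One else Zero) # enc_nat (nat \<bar>i\<bar>)"

definition enc_num :: "num_desc \<Rightarrow> sym list" where
  "enc_num x = concat (map (\<lambda>(p, q). enc_int p @ [Slash] @ enc_nat q @ [Comma]) x) @ [Semicolon]"

text \<open>The number of variables, the rank, and the indices of the variables are dimensions and
  positions, and are written in unary. For formulas, this makes the number of variables a lower
  bound on the input length; the indices are smaller than the number of variables, so writing them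
  in binary would change the input length only polynomially.\<close>

definition enc_cvp :: "cvp_desc \<Rightarrow> sym list" where
  "enc_cvp D = (case D of (n, R, t, r) \<Rightarrow>
     replicate n One @ [Hash] @
     concat (map (\<lambda>row. concat (map enc_num row) @ [Hash]) R) @
     concat (map enc_num t) @ [Hash] @
     enc_num r)"

definition enc_clause :: "clause \<Rightarrow> sym list" where
  "enc_clause c =
     concat (map (\<lambda>(i, b). (if b then One else Zero) # replicate i One @ [Comma]) c) @ [Semicolon]"

definition enc_formula :: "formula \<Rightarrow> sym list" where
  "enc_formula \<Phi> = replicate (fst \<Phi>) One @ [Hash] @ concat (map enc_clause (snd \<Phi>))"

end

theory Submission
  imports Defs "Jordan_Normal_Form.DL_Rank"
begin

text \<open>
  Write \<open>y\<close> for the value of a literal at an integer vector \<open>z\<close>: \<open>z i\<close> for a variable and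
  \<open>1 - z i\<close> for its negation. A clause with literal values \<open>y\<^sub>1, ..., y\<^sub>k\<close> contributes
  \<open>\<bar>y\<^sub>1 - 1\<bar> + ... + \<bar>y\<^sub>k - 1\<bar> + \<bar>y\<^sub>1 + ... + y\<^sub>k - 1\<bar>\<close> to the distance. By the triangle
  inequality this is at least \<open>k - 1\<close>, with equality at 0/1-vectors satisfying the clause; and it is
  at least \<open>k + 1\<close> if all \<open>y\<^sub>j \<le> 0\<close>, with equality if they all vanish. All \<open>y\<^sub>j \<le> 0\<close> happens
  exactly when the assignment \<open>z i \<ge> 1\<close> violates the clause, so every lattice point, not only those with
  0/1-coordinates, is at least as far away as an assignment.

  Everything except the number of clauses in the radius can be copied or compared in unary. The Turing
  machine is obtained by compiling a while language whose primitive step acts on all tapes at once.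
  Tape 2 collects the target vector, tape 3 is a binary counter of clauses, and the heads of the
  tapes from 4 on move together along the columns of the matrix: tape 4 delimits the columns, tape 5
  marks the occurring variables, tape 6 the diagonal, and tape \<open>7 + j\<close> has the sign of the
  \<open>j\<close>-th literal of the current clause in the cell of its variable.
\<close>

section \<open>A while language for multitape machines\<close>

text \<open>The two clause costs \<open>k - 1\<close> and \<open>k + 1\<close> differ by 2, so an
  assignment satisfying \<open>s\<close> of \<open>m\<close> clauses lies at distance
  \<open>m * (k + 1) - 2 * s\<close>. This explains the radius
  \<open>m * (k + 1 - 2 * \<epsilon>)\<close> and the ratio \<open>\<gamma>\<close>, whose numerator
  and denominator simplify to \<open>k + 1 - 2 * \<delta>\<close> and
  \<open>k + 1 - 2 * \<epsilon>\<close>. The obstacle is arithmetic on the machine, the more so as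
  the parameters are arbitrary reals. Up to a common factor the entries of matrix and target are
  integers between \<open>-k\<close> and \<open>k\<close>, so their codes form a finite table built
  into the control. Only the radius involves an unbounded number. The common factor
  \<open>\<alpha>\<close> of basis, target and radius is free; it is chosen such that the code of
  the radius is fixed text interspersed with copies of the binary code of \<open>m\<close>, and no
  multiplication is ever carried out.\<close>

datatype prog =
    Op "(nat \<Rightarrow> sym) \<Rightarrow> nat \<Rightarrow> sym \<times> dir"
  | Seq prog prog (infixr "\<then>" 60)
  | Cond "(nat \<Rightarrow> sym) \<Rightarrow> bool" prog prog
  | While "(nat \<Rightarrow> sym) \<Rightarrow> bool" prog

abbreviation reads :: "(nat \<Rightarrow> tape) \<Rightarrow> nat \<Rightarrow> sym" where
  "reads \<sigma> \<equiv> (\<lambda>i. read (\<sigma> i))"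

text \<open>A test takes a step of its own, in which the machine only changes its state. The number
  of steps is exact, so that it can be matched with iterates of \<open>step\<close>.\<close>

inductive exec :: "prog \<Rightarrow> (nat \<Rightarrow> tape) \<Rightarrow> nat \<Rightarrow> (nat \<Rightarrow> tape) \<Rightarrow> bool" where
  Op: "exec (Op f) \<sigma> 1 (\<lambda>i. act (f (reads \<sigma>) i) (\<sigma> i))"
| Seq: "exec p \<sigma> m \<sigma>' \<Longrightarrow> exec q \<sigma>' n \<sigma>'' \<Longrightarrow> exec (p \<then> q) \<sigma> (m + n) \<sigma>''"
| CondT: "t (reads \<sigma>) \<Longrightarrow> exec p \<sigma> n \<sigma>' \<Longrightarrow> exec (Cond t p q) \<sigma> (Suc n) \<sigma>'"
| CondF: "\<not> t (reads \<sigma>) \<Longrightarrow> exec q \<sigma> n \<sigma>' \<Longrightarrow> exec (Cond t p q) \<sigma> (Suc n) \<sigma>'"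
| WhileT: "t (reads \<sigma>) \<Longrightarrow> exec p \<sigma> m \<sigma>' \<Longrightarrow> exec (While t p) \<sigma>' n \<sigma>'' \<Longrightarrow>
    exec (While t p) \<sigma> (Suc (m + n)) \<sigma>''"
| WhileF: "\<not> t (reads \<sigma>) \<Longrightarrow> exec (While t p) \<sigma> 1 \<sigma>"

primrec psize :: "prog \<Rightarrow> nat" where
  "psize (Op f) = 1"
| "psize (p \<then> q) = psize p + psize q"
| "psize (Cond t p q) = Suc (psize p + psize q)"
| "psize (While t p) = Suc (psize p)"

text \<open>The code of a program occupies the states from \<open>b\<close> on and leaves to the state \<open>e\<close>.\<close>

primrec code ::
    "prog \<Rightarrow> nat \<Rightarrow> nat \<Rightarrow> nat \<Rightarrow> (nat \<Rightarrow> sym) \<Rightarrow> nat \<times> (nat \<Rightarrow> sym \<times> dir)" where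
  "code (Op f) b e s r = (e, f r)"
| "code (p \<then> q) b e s r =
    (if s < b + psize p then code p b (b + psize p) s r else code q (b + psize p) e s r)"
| "code (Cond t p q) b e s r =
    (if s = b then (if t r then Suc b else Suc (b + psize p), \<lambda>i. (r i, Stay))
     else if s < Suc (b + psize p) then code p (Suc b) e s r
     else code q (Suc (b + psize p)) e s r)"
| "code (While t p) b e s r =
    (if s = b then (if t r then Suc b else e, \<lambda>i. (r i, Stay)) else code p (Suc b) b s r)"

lemma psize_pos: "0 < psize p"
  by (induction p) auto

text \<open>Serves the well-formedness of the compiled machine: every jump stays inside the block or
  goes to its exit, so with the halting state as \<open>h\<close> no transition leaves the range of
  states.\<close>

lemma code_target:
  "b \<le> s \<Longrightarrow> s < b + psize p \<Longrightarrow> b + psize p \<le> h \<Longrightarrow> e \<le> h \<Longrightarrow> fst (code p b e s r) \<le> h"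
proof (induction p arbitrary: b e)
  case (Seq p q)
  show ?case
  proof (cases "s < b + psize p")
    case True
    with Seq.prems show ?thesis using Seq.IH(1)[of b "b + psize p"] by auto
  next
    case False
    with Seq.prems show ?thesis using Seq.IH(2)[of "b + psize p" e] by auto
  qed
next
  case (Cond t p q)
  consider "s = b" | "s \<noteq> b" "s < Suc (b + psize p)" | "s \<ge> Suc (b + psize p)" by linarith
  then show ?case
  proof cases
    case 1
    with Cond.prems psize_pos[of p] psize_pos[of q] show ?thesis by auto
  next
    case 2
    with Cond.prems show ?thesis using Cond.IH(1)[of "Suc b" e] by auto
  next
    case 3
    with Cond.prems show ?thesis using Cond.IH(2)[of "Suc (b + psize p)" e] by auto
  qed
next
  case (While t p)
  show ?case
  proof (cases "s = b")
    case True
    with While.prems psize_pos[of p] show ?thesis by auto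
  next
    case False
    with While.prems show ?thesis using While.IH[of "Suc b" b] by auto
  qed
qed auto

definition agree :: "nat \<Rightarrow> (nat \<Rightarrow> 'a) \<Rightarrow> (nat \<Rightarrow> 'a) \<Rightarrow> bool" where
  "agree K r r' \<longleftrightarrow> (\<forall>i<K. r i = r' i)"

text \<open>The program inspects only the tapes below \<open>K\<close> (what it does to the others is irrelevant).\<close>

primrec tapes_below :: "nat \<Rightarrow> prog \<Rightarrow> bool" where
  "tapes_below K (Op f) \<longleftrightarrow> (\<forall>r r'. agree K r r' \<longrightarrow> agree K (f r) (f r'))"
| "tapes_below K (p \<then> q) \<longleftrightarrow> tapes_below K p \<and> tapes_below K q"
| "tapes_below K (Cond t p q) \<longleftrightarrow>
    (\<forall>r r'. agree K r r' \<longrightarrow> t r = t r') \<and> tapes_below K p \<and> tapes_below K q"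
| "tapes_below K (While t p) \<longleftrightarrow>
    (\<forall>r r'. agree K r r' \<longrightarrow> t r = t r') \<and> tapes_below K p"

text \<open>Programs act on infinitely many tapes, a machine on \<open>K\<close> of them. This is
  what makes the truncation to the tapes below \<open>K\<close> faithful.\<close>

lemma code_agree:
  assumes "tapes_below K p" "agree K r r'"
  shows "fst (code p b e s r) = fst (code p b e s r') \<and>
    agree K (snd (code p b e s r)) (snd (code p b e s r'))"
  using assms
proof (induction p arbitrary: b e)
  case (Cond t p q)
  then have "t r = t r'" by auto
  with Cond show ?case by (cases "t r"; cases "t r'") (auto simp: agree_def)
next
  case (While t p)
  then have "t r = t r'" by auto
  with While show ?case by (cases "t r"; cases "t r'") (auto simp: agree_def)
qed (auto simp: agree_def)

definition compile :: "nat \<Rightarrow> prog \<Rightarrow> tm" where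
  "compile K p = \<lparr>tapes = K, states = psize p,
     trans = \<lambda>s xs. let c = code p 0 (psize p) s (\<lambda>i. xs ! i) in (fst c, map (snd c) [0..<K])\<rparr>"

lemma wf_compile: "2 \<le> K \<Longrightarrow> wf_tm (compile K p)"
  using code_target[of 0 _ p "psize p" "psize p"] by (auto simp: wf_tm_def compile_def Let_def)

lemma step_compile:
  assumes "tapes_below K p" "s < psize p"
  shows "step (compile K p) (s, map \<sigma> [0..<K]) =
    (let c = code p 0 (psize p) s (reads \<sigma>) in (fst c, map (\<lambda>i. act (snd c i) (\<sigma> i)) [0..<K]))"
proof -
  let ?xs = "map read (map \<sigma> [0..<K])"
  \<comment> \<open>Beyond \<open>K\<close> the list lookup returns unspecified symbols, so
    agreement holds only below \<open>K\<close>.\<close>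
  have ag: "agree K (\<lambda>i. ?xs ! i) (reads \<sigma>)" by (auto simp: agree_def)
  note c = code_agree[OF assms(1) ag, of 0 "psize p" s]
  have "map2 act (map (snd (code p 0 (psize p) s (\<lambda>i. ?xs ! i))) [0..<K]) (map \<sigma> [0..<K]) =
    map (\<lambda>i. act (snd (code p 0 (psize p) s (reads \<sigma>)) i) (\<sigma> i)) [0..<K]"
    using c by (intro nth_equalityI) (auto simp: agree_def)
  then show ?thesis
    using assms(2) c by (simp add: step_def compile_def Let_def del: map_map)
qed

lemma act_read [simp]: "act (read t, Stay) t = t"
  by (simp add: act_def read_def)

lemma step_compile_stay:
  assumes "tapes_below K p" "s < psize p"
    and "code p 0 (psize p) s (reads \<sigma>) = (s', \<lambda>i. (read (\<sigma> i), Stay))"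
  shows "step (compile K p) (s, map \<sigma> [0..<K]) = (s', map \<sigma> [0..<K])"
  using step_compile[OF assms(1,2)] assms(3) by simp

text \<open>The induction has to range over subprograms at an arbitrary place and with an arbitrary
  exit, since the body of a loop exits to the test of the loop and the left half of a sequence to
  its right half. The hypothesis on \<open>code\<close> says that \<open>q\<close> is the block of
  \<open>p\<close> starting at \<open>b\<close>.\<close>

lemma exec_steps:
  assumes "exec q \<sigma> n \<sigma>'" "tapes_below K p"
    and "\<And>s r. b \<le> s \<Longrightarrow> s < b + psize q \<Longrightarrow> code p 0 (psize p) s r = code q b e s r"
    and "b + psize q \<le> psize p"
  shows "(step (compile K p) ^^ n) (b, map \<sigma> [0..<K]) = (e, map \<sigma>' [0..<K])"
  using assms
proof (induction arbitrary: b e rule: exec.induct)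
  case (Op f \<sigma>)
  then show ?case using step_compile[of K p b \<sigma>] by (simp add: Let_def)
next
  case (Seq q1 \<sigma> m \<sigma>' q2 n \<sigma>'')
  have "(step (compile K p) ^^ m) (b, map \<sigma> [0..<K]) = (b + psize q1, map \<sigma>' [0..<K])"
    by (rule Seq.IH(1)) (use Seq.prems in simp_all)
  moreover have "(step (compile K p) ^^ n) (b + psize q1, map \<sigma>' [0..<K]) = (e, map \<sigma>'' [0..<K])"
    by (rule Seq.IH(2)) (use Seq.prems in simp_all)
  ultimately have "(step (compile K p) ^^ (n + m)) (b, map \<sigma> [0..<K]) = (e, map \<sigma>'' [0..<K])"
    by (simp only: funpow_add o_apply)
  then show ?case by (simp only: add.commute)
next
  case (CondT t \<sigma> q1 n \<sigma>' q2)
  have "step (compile K p) (b, map \<sigma> [0..<K]) = (Suc b, map \<sigma> [0..<K])"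
    by (rule step_compile_stay) (use CondT.prems CondT.hyps in simp_all)
  moreover have "(step (compile K p) ^^ n) (Suc b, map \<sigma> [0..<K]) = (e, map \<sigma>' [0..<K])"
    by (rule CondT.IH) (use CondT.prems in simp_all)
  ultimately show ?case by (simp only: funpow_Suc_right o_apply)
next
  case (CondF t \<sigma> q2 n \<sigma>' q1)
  have "step (compile K p) (b, map \<sigma> [0..<K]) = (Suc (b + psize q1), map \<sigma> [0..<K])"
    by (rule step_compile_stay) (use CondF.prems CondF.hyps in simp_all)
  moreover have "(step (compile K p) ^^ n) (Suc (b + psize q1), map \<sigma> [0..<K]) = (e, map \<sigma>' [0..<K])"
    by (rule CondF.IH) (use CondF.prems in simp_all)
  ultimately show ?case by (simp only: funpow_Suc_right o_apply)
next
  case (WhileT t \<sigma> q m \<sigma>' n \<sigma>'')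
  have "step (compile K p) (b, map \<sigma> [0..<K]) = (Suc b, map \<sigma> [0..<K])"
    by (rule step_compile_stay) (use WhileT.prems WhileT.hyps in simp_all)
  moreover have "(step (compile K p) ^^ m) (Suc b, map \<sigma> [0..<K]) = (b, map \<sigma>' [0..<K])"
    by (rule WhileT.IH(1)) (use WhileT.prems in simp_all)
  moreover have "(step (compile K p) ^^ n) (b, map \<sigma>' [0..<K]) = (e, map \<sigma>'' [0..<K])"
    by (rule WhileT.IH(2)) (use WhileT.prems in simp_all)
  ultimately have "(step (compile K p) ^^ Suc (n + m)) (b, map \<sigma> [0..<K]) = (e, map \<sigma>'' [0..<K])"
    by (simp only: funpow_Suc_right funpow_add o_apply)
  then show ?case by (simp only: add.commute)
next
  case (WhileF t \<sigma> q)
  have "step (compile K p) (b, map \<sigma> [0..<K]) = (e, map \<sigma> [0..<K])"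
    by (rule step_compile_stay) (use WhileF in simp_all)
  then show ?case by simp
qed

text \<open>Upper bounds replace exact counts because the rounds of a loop may differ in
  length.\<close>

definition runs :: "prog \<Rightarrow> (nat \<Rightarrow> tape) \<Rightarrow> nat \<Rightarrow> (nat \<Rightarrow> tape) \<Rightarrow> bool" where
  "runs p \<sigma> T \<sigma>' \<longleftrightarrow> (\<exists>n\<le>T. exec p \<sigma> n \<sigma>')"

lemma step_halted: "(step M ^^ n) (states M, ts) = (states M, ts)"
  by (induction n) (auto simp: step_def)

theorem compile_outputs_within:
  assumes "runs p \<sigma> T \<sigma>'" "tapes_below K p" "2 \<le> K"
    and "\<And>i. \<sigma> i = (if i = 0 then (contents w, 0) else (contents [], 0))"
    and "fst (\<sigma>' 1) = contents v"
  shows "outputs_within (compile K p) w T v"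
proof -
  obtain n where n: "n \<le> T" "exec p \<sigma> n \<sigma>'" using assms(1) by (auto simp: runs_def)
  have init: "init_config (compile K p) w = (0, map \<sigma> [0..<K])"
    using assms(3,4) by (auto simp: init_config_def compile_def nth_Cons' intro!: nth_equalityI)
  have "(step (compile K p) ^^ n) (0, map \<sigma> [0..<K]) = (psize p, map \<sigma>' [0..<K])"
    by (rule exec_steps[OF n(2) assms(2)]) auto
  \<comment> \<open>\<open>outputs_within\<close> looks at the configuration after exactly
    \<open>T\<close> steps; the halting state is absorbing, so the remaining \<open>T - n\<close>
    steps change nothing.\<close>
  then have "(step (compile K p) ^^ (T - n + n)) (0, map \<sigma> [0..<K]) = (psize p, map \<sigma>' [0..<K])"
    using step_halted[of "T - n" "compile K p"] by (simp only: funpow_add) (simp add: compile_def)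
  with n(1) assms(3,5) init show ?thesis
    by (simp add: outputs_within_def compile_def)
qed

section \<open>Composition rules for running times\<close>

lemma runsI: "exec p \<sigma> n \<sigma>' \<Longrightarrow> n \<le> T \<Longrightarrow> runs p \<sigma> T \<sigma>'"
  unfolding runs_def by blast

lemma runsE:
  assumes "runs p \<sigma> T \<sigma>'"
  obtains n where "n \<le> T" "exec p \<sigma> n \<sigma>'"
  using assms unfolding runs_def by blast

lemma runs_mono: "runs p \<sigma> T \<sigma>' \<Longrightarrow> T \<le> T' \<Longrightarrow> runs p \<sigma> T' \<sigma>'"
  by (elim runsE) (rule runsI, assumption, simp)

lemma runs_Op: "\<sigma>' = (\<lambda>i. act (f (reads \<sigma>) i) (\<sigma> i)) \<Longrightarrow> runs (Op f) \<sigma> 1 \<sigma>'"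
  using runsI[OF exec.Op[of f \<sigma>] order_refl] by simp

lemma runs_Seq: "runs p \<sigma> S \<sigma>' \<Longrightarrow> runs q \<sigma>' T \<sigma>'' \<Longrightarrow> runs (p \<then> q) \<sigma> (S + T) \<sigma>''"
  by (elim runsE) (rule runsI, erule (1) exec.Seq, simp)

lemma runs_CondT: "t (reads \<sigma>) \<Longrightarrow> runs p \<sigma> T \<sigma>' \<Longrightarrow> runs (Cond t p q) \<sigma> (Suc T) \<sigma>'"
  by (elim runsE) (rule runsI, erule (1) exec.CondT, simp)

lemma runs_CondF: "\<not> t (reads \<sigma>) \<Longrightarrow> runs q \<sigma> T \<sigma>' \<Longrightarrow> runs (Cond t p q) \<sigma> (Suc T) \<sigma>'"
  by (elim runsE) (rule runsI, erule (1) exec.CondF, simp)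

text \<open>The explicit family \<open>s\<close> of states takes the place of an invariant. Each
  round pays one step for its test, and the failing test at the end pays one more.\<close>

lemma runs_While:
  assumes "\<And>i. i < N \<Longrightarrow> t (reads (s i)) \<and> runs p (s i) T (s (Suc i))"
    and "\<not> t (reads (s N))"
  shows "runs (While t p) (s 0) (N * Suc T + 1) (s N)"
  using assms
proof (induction N arbitrary: s)
  case 0
  then show ?case using runsI[OF exec.WhileF[of t "s 0" p]] by simp
next
  case (Suc N)
  from Suc.prems(1)[of 0] obtain m where m: "t (reads (s 0))" "m \<le> T" "exec p (s 0) m (s 1)"
    by (auto elim: runsE)
  have "runs (While t p) (s (Suc 0)) (N * Suc T + 1) (s (Suc N))"
    by (rule Suc.IH[of "\<lambda>i. s (Suc i)"]) (use Suc.prems in auto)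
  then obtain n where n: "n \<le> N * Suc T + 1" "exec (While t p) (s 1) n (s (Suc N))"
    by (auto elim: runsE)
  have "exec (While t p) (s 0) (Suc (m + n)) (s (Suc N))"
    by (rule exec.WhileT) (use m n in auto)
  moreover have "Suc (m + n) \<le> Suc N * Suc T + 1" using m(2) n(1) by simp
  ultimately show ?case by (rule runsI)
qed

section \<open>Tape contents and elementary routines\<close>

lemma contents_snoc: "(contents u)(int (length u) := s) = contents (u @ [s])"
  by (auto simp: contents_def nth_append fun_eq_iff)

lemma contents_length [simp]: "contents u (int (length u)) = Blank"
  by (simp add: contents_def)

lemma contents_neg [simp]: "i < 0 \<Longrightarrow> contents u i = Blank"
  by (simp add: contents_def)

lemma contents_nth: "i < length u \<Longrightarrow> contents u (int i) = u ! i"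
  by (simp add: contents_def)

lemma contents_append_right: "0 \<le> i \<Longrightarrow> contents (u @ v) (int (length u) + i) = contents v i"
  by (auto simp: contents_def nth_append nat_add_distrib)

lemma contents_replicate:
  "contents (replicate n s) i = (if 0 \<le> i \<and> i < int n then s else Blank)"
  by (auto simp: contents_def)

lemma contents_Nil [simp]: "contents [] = (\<lambda>_. Blank)"
  by (rule ext) (auto simp: contents_def)

definition skip :: prog where
  "skip = Op (\<lambda>r i. (r i, Stay))"

definition mv :: "nat set \<Rightarrow> dir \<Rightarrow> prog" where
  "mv A d = Op (\<lambda>r i. (r i, if i \<in> A then d else Stay))"

definition put :: "nat \<Rightarrow> sym \<Rightarrow> prog" where
  "put i s = Op (\<lambda>r j. if j = i then (s, To_Right) else (r j, Stay))"

definition emit :: "nat \<Rightarrow> sym list \<Rightarrow> prog" where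
  "emit i w = foldr (\<lambda>s p. put i s \<then> p) w skip"

text \<open>The head may stand on the blank behind the word, where a scan for blanks would stop at
  once; hence the move to the left before the loop. The scan ends on cell -1, hence the move to the
  right after it.\<close>

definition rewind :: "nat \<Rightarrow> prog" where
  "rewind i = mv {i} To_Left \<then> While (\<lambda>r. r i \<noteq> Blank) (mv {i} To_Left) \<then> mv {i} To_Right"

definition copy :: "nat \<Rightarrow> nat \<Rightarrow> prog" where
  "copy i j = While (\<lambda>r. r i \<noteq> Blank)
     (Op (\<lambda>r l. if l = j then (r i, To_Right) else (r l, if l = i then To_Right else Stay)))"

text \<open>With the least significant bit at cell 0 the carry travels to the right, and the number
  can grow into the blank cells there.\<close>

definition incr :: "nat \<Rightarrow> prog" where
  "incr i = While (\<lambda>r. r i = One) (put i Zero) \<then>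
     Op (\<lambda>r j. (if j = i then One else r j, Stay)) \<then> rewind i"

text \<open>Emitting a word takes several steps, so the choice of the word has to be turned into a
  branch of the control: one test for each possible value.\<close>

definition switch :: "((nat \<Rightarrow> sym) \<Rightarrow> 'v) \<Rightarrow> 'v list \<Rightarrow> ('v \<Rightarrow> prog) \<Rightarrow> prog" where
  "switch g vs P = foldr (\<lambda>v p. Cond (\<lambda>r. g r = v) (P v) p) vs skip"

lemma runs_skip: "runs skip \<sigma> 1 \<sigma>"
  unfolding skip_def by (rule runs_Op) auto

lemma runs_mv:
  assumes "\<sigma>' = (\<lambda>j. if j \<in> A then (fst (\<sigma> j), snd (\<sigma> j) + offset d) else \<sigma> j)"
  shows "runs (mv A d) \<sigma> 1 \<sigma>'"
  unfolding mv_def by (rule runs_Op) (auto simp: assms act_def read_def fun_eq_iff)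

lemma runs_put:
  assumes "\<sigma> i = (f, x)"
  shows "runs (put i s) \<sigma> 1 (\<sigma>(i := (f(x := s), x + 1)))"
  unfolding put_def by (rule runs_Op) (auto simp: assms act_def read_def fun_eq_iff)

lemma runs_emit:
  assumes "\<sigma> i = (contents u, int (length u))"
  shows "runs (emit i w) \<sigma> (length w + 1) (\<sigma>(i := (contents (u @ w), int (length (u @ w)))))"
  using assms
proof (induction w arbitrary: \<sigma> u)
  case Nil
  then have "\<sigma>(i := (contents (u @ []), int (length (u @ [])))) = \<sigma>" by auto
  then show ?case using runs_skip[of \<sigma>] by (simp add: emit_def)
next
  case (Cons s w)
  let ?\<sigma>' = "\<sigma>(i := (contents (u @ [s]), int (length (u @ [s]))))"
  have "runs (put i s) \<sigma> 1 ?\<sigma>'"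
    using runs_put[of \<sigma> i "contents u" "int (length u)" s] Cons.prems by (simp add: contents_snoc add.commute)
  moreover have "runs (emit i w) ?\<sigma>' (length w + 1)
      (?\<sigma>'(i := (contents ((u @ [s]) @ w), int (length ((u @ [s]) @ w)))))"
    by (rule Cons.IH) (rule fun_upd_same)
  ultimately have "runs (put i s \<then> emit i w) \<sigma> (1 + (length w + 1))
      (?\<sigma>'(i := (contents ((u @ [s]) @ w), int (length ((u @ [s]) @ w)))))"
    by (rule runs_Seq)
  moreover have "emit i (s # w) = put i s \<then> emit i w"
    by (simp add: emit_def)
  ultimately show ?case by (simp only: fun_upd_upd append_assoc append.simps) (simp add: fun_upd_def)
qed

lemma runs_rewind:
  assumes "\<sigma> i = (contents w, int x)" "x \<le> length w" "Blank \<notin> set w"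
  shows "runs (rewind i) \<sigma> (2 * length w + 3) (\<sigma>(i := (contents w, 0)))"
proof -
  let ?s = "\<lambda>j. \<sigma>(i := (contents w, int x - 1 - int j))"
  have 1: "runs (mv {i} To_Left) \<sigma> 1 (?s 0)"
    by (rule runs_mv) (auto simp: assms)
  have "runs (While (\<lambda>r. r i \<noteq> Blank) (mv {i} To_Left)) (?s 0) (x * Suc 1 + 1) (?s x)"
  proof (rule runs_While[of x _ ?s])
    fix j assume "j < x"
    then have "w ! nat (int x - 1 - int j) \<in> set w"
      using assms(2) by (intro nth_mem) linarith
    then have "w ! nat (int x - 1 - int j) \<noteq> Blank" using assms(3) by metis
    with \<open>j < x\<close> assms have "contents w (int x - 1 - int j) \<noteq> Blank"
      by (auto simp: contents_def)
    moreover have "runs (mv {i} To_Left) (?s j) 1 (?s (Suc j))"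
      by (rule runs_mv) auto
    ultimately show "reads (?s j) i \<noteq> Blank \<and> runs (mv {i} To_Left) (?s j) 1 (?s (Suc j))"
      by (simp add: read_def)
  qed (simp add: read_def)
  moreover have "runs (mv {i} To_Right) (?s x) 1 (\<sigma>(i := (contents w, 0)))"
    by (rule runs_mv) auto
  ultimately have "runs (rewind i) \<sigma> (1 + (x * Suc 1 + 1 + 1)) (\<sigma>(i := (contents w, 0)))"
    unfolding rewind_def using 1 by (blast intro: runs_Seq)
  then show ?thesis by (rule runs_mono) (use assms in simp)
qed

lemma runs_copy:
  assumes "\<sigma> i = (contents w, 0)" "\<sigma> j = (contents u, int (length u))" "i \<noteq> j" "Blank \<notin> set w"
  shows "runs (copy i j) \<sigma> (2 * length w + 1)
    (\<sigma>(i := (contents w, int (length w)), j := (contents (u @ w), int (length (u @ w)))))"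
proof -
  let ?s = "\<lambda>x. \<sigma>(i := (contents w, int x),
    j := (contents (u @ take x w), int (length (u @ take x w))))"
  have "runs (copy i j) (?s 0) (length w * Suc 1 + 1) (?s (length w))"
    unfolding copy_def
  proof (rule runs_While[of _ _ ?s])
    fix x assume x: "x < length w"
    then have "w ! x \<noteq> Blank" using assms(4) by (metis nth_mem)
    moreover have "runs (Op (\<lambda>r l. if l = j then (r i, To_Right)
        else (r l, if l = i then To_Right else Stay))) (?s x) 1 (?s (Suc x))"
      using x assms(3) contents_snoc[of "u @ take x w" "w ! x"]
      by (intro runs_Op) (auto simp: fun_eq_iff act_def read_def contents_nth take_Suc_conv_app_nth)
    ultimately show "reads (?s x) i \<noteq> Blank \<and> runs (Op (\<lambda>r l. if l = j then (r i, To_Right)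
        else (r l, if l = i then To_Right else Stay))) (?s x) 1 (?s (Suc x))"
      using x assms(3) by (simp add: read_def contents_nth)
  qed (use assms(3) in \<open>simp add: read_def\<close>)
  moreover have "?s 0 = \<sigma>" using assms by auto
  ultimately show ?thesis by (simp add: mult_2)
qed

section \<open>The binary counter\<close>

lemma enc_nat_0 [simp]: "enc_nat 0 = []"
  by (simp add: enc_nat.simps)

lemma enc_nat_double: "0 < n \<Longrightarrow> enc_nat (2 * n) = Zero # enc_nat n"
  by (simp add: enc_nat.simps[of "2 * n"])

lemma enc_nat_double_Suc: "enc_nat (Suc (2 * n)) = One # enc_nat n"
  by (simp add: enc_nat.simps[of "Suc (2 * n)"])

lemma enc_nat_symbols: "set (enc_nat n) \<subseteq> {Zero, One}"
proof (induction n rule: enc_nat.induct)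
  case (1 n)
  then show ?case by (subst enc_nat.simps) auto
qed

lemma Blank_enc_nat: "Blank \<notin> set (enc_nat n)"
  using enc_nat_symbols[of n] by auto

text \<open>A linear bound suffices: the counter only runs up to the number of clauses, which is at
  most the length of the input.\<close>

lemma length_enc_nat: "length (enc_nat n) \<le> n"
proof (induction n rule: enc_nat.induct)
  case (1 n)
  then show ?case by (subst enc_nat.simps) auto
qed

text \<open>The carry turns the initial ones into zeros; the next bit, possibly a blank, becomes a one.\<close>

lemma enc_nat_Suc:
  obtains a v where "enc_nat m = replicate a One @ v" "v = [] \<or> hd v = Zero"
    "enc_nat (Suc m) = replicate a Zero @ One # tl v"
proof -
  have "\<exists>a v. enc_nat m = replicate a One @ v \<and> (v = [] \<or> hd v = Zero) \<and>
    enc_nat (Suc m) = replicate a Zero @ One # tl v"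
  proof (induction m rule: less_induct)
    case (less m)
    consider "m = 0" | n where "m = 2 * n" "0 < n" | n where "m = Suc (2 * n)"
      by (metis evenE oddE gr0I mult_0_right Suc_eq_plus1)
    then show ?case
    proof cases
      case 1
      then show ?thesis
        using enc_nat_double_Suc[of 0] by (intro exI[of _ 0] exI[of _ "[]"]) simp
    next
      case 2
      then show ?thesis
        by (intro exI[of _ 0] exI[of _ "enc_nat m"])
          (simp add: enc_nat_double enc_nat_double_Suc)
    next
      case 3
      with less[of n] obtain a v where "enc_nat n = replicate a One @ v" "v = [] \<or> hd v = Zero"
        "enc_nat (Suc n) = replicate a Zero @ One # tl v" by auto
      moreover have "Suc m = 2 * Suc n" using 3 by simp
      ultimately show ?thesis
        using 3 enc_nat_double[of "Suc n"]
        by (intro exI[of _ "Suc a"] exI[of _ v]) (simp add: enc_nat_double_Suc)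
    qed
  qed
  then show ?thesis using that by blast
qed

lemma runs_incr:
  assumes "\<sigma> i = (contents (enc_nat m), 0)"
  shows "runs (incr i) \<sigma> (4 * m + 8) (\<sigma>(i := (contents (enc_nat (Suc m)), 0)))"
proof -
  obtain a v where av: "enc_nat m = replicate a One @ v" "v = [] \<or> hd v = Zero"
    "enc_nat (Suc m) = replicate a Zero @ One # tl v" by (rule enc_nat_Suc)
  let ?s = "\<lambda>x. \<sigma>(i := (contents (replicate x Zero @ replicate (a - x) One @ v), int x))"
  have "runs (While (\<lambda>r. r i = One) (put i Zero)) (?s 0) (a * Suc 1 + 1) (?s a)"
  proof (rule runs_While[of _ _ ?s])
    fix x assume x: "x < a"
    then obtain y where y: "a - x = Suc y" "a - Suc x = y" by (metis Suc_diff_Suc)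
    have "(contents (replicate x Zero @ replicate (a - x) One @ v))(int x := Zero) =
      contents (replicate (Suc x) Zero @ replicate (a - Suc x) One @ v)"
      unfolding y by (auto simp: fun_eq_iff contents_def nth_append nth_Cons' )
    then have "runs (put i Zero) (?s x) 1 (?s (Suc x))"
      using runs_put[of "?s x" i "contents (replicate x Zero @ replicate (a - x) One @ v)" "int x" Zero]
      by (simp add: add.commute)
    moreover have "contents (replicate x Zero @ replicate (a - x) One @ v) (int x) = One"
      using x by (auto simp: contents_def nth_append)
    ultimately show "reads (?s x) i = One \<and> runs (put i Zero) (?s x) 1 (?s (Suc x))"
      by (simp add: read_def)
  next
    \<comment> \<open>Behind the block of ones there is a zero or, if \<open>v\<close> is empty, a
      blank; either way the carry stops.\<close>
    have "contents (replicate a Zero @ v) (int a) \<noteq> One"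
      using av(2) contents_append_right[of 0 "replicate a Zero" v]
      by (cases v) (auto simp: contents_def)
    then show "\<not> reads (?s a) i = One" by (simp add: read_def)
  qed
  moreover have "?s 0 = \<sigma>" using assms av by auto
  ultimately have 1: "runs (While (\<lambda>r. r i = One) (put i Zero)) \<sigma> (2 * a + 1) (?s a)"
    by (simp add: mult_2)
  have "(contents (replicate a Zero @ v))(int a := One) = contents (enc_nat (Suc m))"
    unfolding av(3) by (cases v) (auto simp: fun_eq_iff contents_def nth_append nth_Cons')
  then have 2: "runs (Op (\<lambda>r j. (if j = i then One else r j, Stay))) (?s a) 1
      (\<sigma>(i := (contents (enc_nat (Suc m)), int a)))"
    by (intro runs_Op) (auto simp: fun_eq_iff act_def read_def)
  have len: "a \<le> m" "length (enc_nat (Suc m)) \<le> Suc m" "a \<le> length (enc_nat (Suc m))"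
    using length_enc_nat[of m] length_enc_nat[of "Suc m"] av by auto
  then have 3: "runs (rewind i) (\<sigma>(i := (contents (enc_nat (Suc m)), int a)))
      (2 * length (enc_nat (Suc m)) + 3) (\<sigma>(i := (contents (enc_nat (Suc m)), 0)))"
    using runs_rewind[of "\<sigma>(i := (contents (enc_nat (Suc m)), int a))" i "enc_nat (Suc m)" a]
    by (simp add: Blank_enc_nat)
  have "runs (incr i) \<sigma> (2 * a + 1 + (1 + (2 * length (enc_nat (Suc m)) + 3)))
      (\<sigma>(i := (contents (enc_nat (Suc m)), 0)))"
    unfolding incr_def by (intro runs_Seq[OF 1] runs_Seq[OF 2] 3)
  then show ?thesis by (rule runs_mono) (use len in simp)
qed

lemma runs_switch:
  assumes "g (reads \<sigma>) \<in> set vs" "runs (P (g (reads \<sigma>))) \<sigma> T \<sigma>'"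
  shows "runs (switch g vs P) \<sigma> (length vs + T) \<sigma>'"
  using assms(1)
proof (induction vs)
  case (Cons v vs)
  show ?case
  proof (cases "g (reads \<sigma>) = v")
    case True
    then have "runs (switch g (v # vs) P) \<sigma> (Suc T) \<sigma>'"
      using assms(2) by (auto simp: switch_def intro: runs_CondT)
    then show ?thesis by (rule runs_mono) simp
  next
    case False
    with Cons have "runs (switch g vs P) \<sigma> (length vs + T) \<sigma>'" by auto
    with False show ?thesis by (auto simp: switch_def intro: runs_CondF)
  qed
qed simp

section \<open>Abstract states of the tapes\<close>

record st =
  inp :: "int \<Rightarrow> sym"
  pos :: int
  outp :: "sym list"
  targ :: "sym list"
  count :: nat
  ncol :: nat
  used :: "int \<Rightarrow> sym"
  diag :: "int \<Rightarrow> sym"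
  off :: nat
  mark :: "nat \<Rightarrow> int \<Rightarrow> sym"
  column :: int

text \<open>Valid at the points where routines hand over to each other. Heads determined by the
  contents are not stored: those of output and targets stand behind the last symbol, that of the
  counter on its lowest bit. The common field \<open>column\<close> keeps the tapes from 4 on in
  lockstep.\<close>

definition conf :: "st \<Rightarrow> nat \<Rightarrow> tape" where
  "conf S i = (
     if i = 0 then (inp S, pos S)
     else if i = 1 then (contents (outp S), int (length (outp S)))
     else if i = 2 then (contents (targ S), int (length (targ S)))
     else if i = 3 then (contents (enc_nat (count S)), 0)
     else if i = 4 then (contents (replicate (ncol S) One), column S)
     else if i = 5 then (used S, column S)
     else if i = 6 then (diag S, column S - int (off S))
     else (mark S (i - 7), column S))"

lemma read_conf [simp]:
  "read (conf S 0) = inp S (pos S)"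
  "read (conf S 4) = (if 0 \<le> column S \<and> column S < int (ncol S) then One else Blank)"
  "read (conf S 5) = used S (column S)"
  "read (conf S 6) = diag S (column S - int (off S))"
  "read (conf S (7 + j)) = mark S j (column S)"
  by (auto simp: conf_def read_def contents_replicate)

lemma runs_emit_outp: "runs (emit 1 w) (conf S) (length w + 1) (conf (S\<lparr>outp := outp S @ w\<rparr>))"
proof -
  have "conf (S\<lparr>outp := outp S @ w\<rparr>) =
    (conf S)(1 := (contents (outp S @ w), int (length (outp S @ w))))"
    by (auto simp: conf_def fun_eq_iff)
  then show ?thesis
    using runs_emit[of "conf S" 1 "outp S" w] by (simp add: conf_def)
qed

lemma runs_emit_targ: "runs (emit 2 w) (conf S) (length w + 1) (conf (S\<lparr>targ := targ S @ w\<rparr>))"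
proof -
  have "conf (S\<lparr>targ := targ S @ w\<rparr>) =
    (conf S)(2 := (contents (targ S @ w), int (length (targ S @ w))))"
    by (auto simp: conf_def fun_eq_iff)
  then show ?thesis
    using runs_emit[of "conf S" 2 "targ S" w] by (simp add: conf_def)
qed

lemma runs_incr_count: "runs (incr 3) (conf S) (4 * count S + 8) (conf (S\<lparr>count := Suc (count S)\<rparr>))"
proof -
  have "conf (S\<lparr>count := Suc (count S)\<rparr>) =
    (conf S)(3 := (contents (enc_nat (Suc (count S))), 0))"
    by (auto simp: conf_def fun_eq_iff)
  then show ?thesis
    using runs_incr[of "conf S" 3 "count S"] by (simp add: conf_def)
qed

lemma runs_mv_inp: "runs (mv {0} To_Right) (conf S) 1 (conf (S\<lparr>pos := pos S + 1\<rparr>))"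
  by (rule runs_mv) (auto simp: conf_def fun_eq_iff)

lemma runs_mv_col: "runs (mv {4..} d) (conf S) 1 (conf (S\<lparr>column := column S + offset d\<rparr>))"
  by (rule runs_mv) (auto simp: conf_def fun_eq_iff)

definition in_columns :: "(nat \<Rightarrow> sym) \<Rightarrow> bool" where
  "in_columns r \<longleftrightarrow> r 4 = One"

lemma in_columns_conf [simp]: "in_columns (reads (conf S)) \<longleftrightarrow> 0 \<le> column S \<and> column S < int (ncol S)"
  by (simp add: in_columns_def)

definition first_col :: prog where
  "first_col = mv {4..} To_Left \<then> While in_columns (mv {4..} To_Left) \<then> mv {4..} To_Right"

lemma runs_first_col:
  assumes "0 \<le> column S" "column S \<le> int (ncol S)"
  shows "runs first_col (conf S) (2 * ncol S + 3) (conf (S\<lparr>column := 0\<rparr>))"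
proof -
  define c where "c = nat (column S)"
  then have c: "column S = int c" "c \<le> ncol S" using assms by auto
  let ?s = "\<lambda>j. conf (S\<lparr>column := int c - 1 - int j\<rparr>)"
  have 1: "runs (mv {4..} To_Left) (conf S) 1 (?s 0)"
    using runs_mv_col[of To_Left S] c by simp
  have 2: "runs (While in_columns (mv {4..} To_Left)) (?s 0) (c * Suc 1 + 1) (?s c)"
  proof (rule runs_While[of _ _ ?s])
    fix j assume "j < c"
    moreover have "runs (mv {4..} To_Left) (?s j) 1 (?s (Suc j))"
      using runs_mv_col[of To_Left "S\<lparr>column := int c - 1 - int j\<rparr>"] by (simp add: algebra_simps)
    ultimately show "in_columns (reads (?s j)) \<and> runs (mv {4..} To_Left) (?s j) 1 (?s (Suc j))"
      using c by simp
  qed simp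
  have 3: "runs (mv {4..} To_Right) (?s c) 1 (conf (S\<lparr>column := 0\<rparr>))"
    using runs_mv_col[of To_Right "S\<lparr>column := int c - 1 - int c\<rparr>"] by simp
  have "runs first_col (conf S) (1 + (c * Suc 1 + 1 + 1)) (conf (S\<lparr>column := 0\<rparr>))"
    unfolding first_col_def by (intro runs_Seq[OF 1] runs_Seq[OF 2] 3)
  then show ?thesis by (rule runs_mono) (use c in simp)
qed

text \<open>Only the cells from the head on are constrained, so that the predicate passes to the
  rest of the word when the head advances.\<close>

definition input_is :: "st \<Rightarrow> sym list \<Rightarrow> bool" where
  "input_is S v \<longleftrightarrow> (\<forall>j\<ge>0. inp S (pos S + j) = contents v j)"

lemma input_isD:
  assumes "input_is S v"
  shows "inp S (pos S) = (case v of [] \<Rightarrow> Blank | x # _ \<Rightarrow> x)"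
proof -
  have "inp S (pos S) = contents v 0" using assms unfolding input_is_def by (metis add_0_right order_refl)
  then show ?thesis by (cases v) (auto simp: contents_def)
qed

lemma input_is_append:
  "input_is S (u @ v) \<Longrightarrow> input_is (S\<lparr>pos := pos S + int (length u)\<rparr>) v"
  unfolding input_is_def
  by (auto simp: contents_append_right add.assoc)

lemma input_is_cong [simp]:
  "input_is (S\<lparr>outp := a1\<rparr>) v = input_is S v"
  "input_is (S\<lparr>targ := a2\<rparr>) v = input_is S v"
  "input_is (S\<lparr>count := a3\<rparr>) v = input_is S v"
  "input_is (S\<lparr>ncol := a4\<rparr>) v = input_is S v"
  "input_is (S\<lparr>used := a5\<rparr>) v = input_is S v"
  "input_is (S\<lparr>diag := a6\<rparr>) v = input_is S v"
  "input_is (S\<lparr>off := a7\<rparr>) v = input_is S v"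
  "input_is (S\<lparr>mark := a8\<rparr>) v = input_is S v"
  "input_is (S\<lparr>column := a9\<rparr>) v = input_is S v"
  by (auto simp: input_is_def)

section \<open>The program of the reduction\<close>

text \<open>The coefficient of \<open>z x\<close> in the sum of the literal values. Literals count
  with multiplicity, and complementary ones cancel.\<close>

definition clause_coeff :: "clause \<Rightarrow> nat \<Rightarrow> int" where
  "clause_coeff c x = (\<Sum>(i, b)\<leftarrow>c. if i = x then if b then 1 else - 1 else 0)"

definition negs :: "clause \<Rightarrow> nat" where
  "negs c = length (filter (\<lambda>l. \<not> snd l) c)"

definition vars :: "clause list \<Rightarrow> nat set" where
  "vars cs = fst ` (\<Union>c\<in>set cs. set c)"

definition clause_rows :: "nat \<Rightarrow> clause \<Rightarrow> int list list" where
  "clause_rows n c =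
     map (\<lambda>l. map (\<lambda>x. of_bool (x = fst l)) [0..<n]) c @ [map (clause_coeff c) [0..<n]]"

text \<open>For a negated literal \<open>\<bar>y - 1\<bar> = \<bar>z i\<bar>\<close>, so the same
  unit row serves both signs and only the target changes from 1 to 0. In the last row each negation
  contributes a constant 1 to the sum, which is moved to the target.\<close>

definition clause_targets :: "clause \<Rightarrow> int list" where
  "clause_targets c = map (\<lambda>l. of_bool (snd l)) c @ [1 - int (negs c)]"

text \<open>A variable without occurrences gets a unit row, to keep the columns independent; for the
  other variables this row is zero.\<close>

definition unused_row :: "nat \<Rightarrow> nat set \<Rightarrow> nat \<Rightarrow> int list" where
  "unused_row n U i = map (\<lambda>x. of_bool (x = i \<and> i \<notin> U)) [0..<n]"

definition red_rows :: "formula \<Rightarrow> int list list" where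
  "red_rows \<Phi> = (case \<Phi> of (n, cs) \<Rightarrow>
     concat (map (clause_rows n) cs) @ map (unused_row n (vars cs)) [0..<n])"

definition red_targets :: "formula \<Rightarrow> int list" where
  "red_targets \<Phi> = (case \<Phi> of (n, cs) \<Rightarrow> concat (map clause_targets cs) @ replicate n 0)"

definition sign_sym :: "bool \<Rightarrow> sym" where
  "sign_sym b = (if b then One else Zero)"

definition enc_lit :: "literal \<Rightarrow> sym list" where
  "enc_lit l = sign_sym (snd l) # replicate (fst l) One @ [Comma]"

lemma enc_clause_eq: "enc_clause c = concat (map enc_lit c) @ [Semicolon]"
  by (auto simp: enc_clause_def enc_lit_def sign_sym_def intro!: arg_cong[where f = concat])

text \<open>One tape per literal position: repeated occurrences of a variable leave their marks on
  different tapes, and the coefficient of a variable is the sum of the signs found in its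
  column.\<close>

definition markers :: "clause \<Rightarrow> nat \<Rightarrow> int \<Rightarrow> sym" where
  "markers c j x = (if j < length c \<and> x = int (fst (c ! j)) then sign_sym (snd (c ! j)) else Blank)"

definition occupied :: "nat set \<Rightarrow> int \<Rightarrow> sym" where
  "occupied U x = (if x \<in> int ` U then One else Blank)"

definition sign_val :: "sym \<Rightarrow> int" where
  "sign_val s = (if s = One then 1 else if s = Zero then - 1 else 0)"

text \<open>The marks in the midst of the pass that writes the last row of a clause. They are erased
  in that pass, which leaves blank tapes for the next clause.\<close>

definition clear_upto :: "nat \<Rightarrow> (nat \<Rightarrow> int \<Rightarrow> sym) \<Rightarrow> nat \<Rightarrow> int \<Rightarrow> sym" where
  "clear_upto n M j x = (if 0 \<le> x \<and> x < int n then Blank else M j x)"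

text \<open>Isolates what the machine needs from a number format, since there are two of them. The
  constant \<open>W\<close> bounds the code of an entry, and the code of the radius is
  \<open>w0\<close> followed by the words of \<open>ws\<close>, each preceded by the binary number
  of clauses.\<close>

locale number_encoding =
  fixes k :: nat and num :: "int \<Rightarrow> num_desc" and rad :: "nat \<Rightarrow> num_desc"
    and w0 :: "sym list" and ws :: "sym list list" and W :: nat
  assumes k: "1 \<le> k"
    and length_num: "\<bar>v\<bar> \<le> int k \<Longrightarrow> length (enc_num (num v)) \<le> W"
    and enc_rad: "0 < m \<Longrightarrow> enc_num (rad m) = w0 @ concat (map (\<lambda>w. enc_nat m @ w) ws)"
begin

definition word :: "int \<Rightarrow> sym list" where
  "word v = enc_num (num v)"

definition enc_row :: "int list \<Rightarrow> sym list" where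
  "enc_row r = concat (map word r) @ [Hash]"

definition advance :: "bool \<Rightarrow> prog" where
  "advance clr = Op (\<lambda>r j. (if clr \<and> 7 \<le> j then Blank else r j, if 4 \<le> j then To_Right else Stay))"

definition row_prog :: "((nat \<Rightarrow> sym) \<Rightarrow> int) \<Rightarrow> int list \<Rightarrow> bool \<Rightarrow> prog" where
  "row_prog g V clr =
     While in_columns (switch g V (\<lambda>v. emit 1 (word v)) \<then> advance clr) \<then>
     emit 1 [Hash] \<then> first_col"

text \<open>Work per column: at most \<open>2 * k + 1\<close> tests, \<open>W + 1\<close> steps of
  output, and a few for the loop and for the way back to column 0. The constant 20 also leaves room
  for fixed costs of the surrounding programs.\<close>

definition Q :: nat where
  "Q = 2 * k + W + 20"

text \<open>The output grows during the loop, but \<open>g\<close> ignores the output tape; so the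
  entries may be computed in a state with an arbitrary output \<open>u\<close>.\<close>

lemma runs_row:
  assumes column: "column S = 0"
    and e: "\<And>c. c < ncol S \<Longrightarrow>
      g (reads (conf (S\<lparr>outp := u, column := int c\<rparr>))) = e c \<and> e c \<in> set V \<and> \<bar>e c\<bar> \<le> int k"
    and g: "\<And>r r'. (\<And>i. i \<noteq> 1 \<Longrightarrow> r i = r' i) \<Longrightarrow> g r = g r'"
    and V: "length V \<le> 2 * k + 1"
  shows "runs (row_prog g V clr) (conf S) (Q * (ncol S + 1))
    (conf (S\<lparr>outp := outp S @ enc_row (map e [0..<ncol S]),
      mark := if clr then clear_upto (ncol S) (mark S) else mark S\<rparr>))"
proof -
  let ?n = "ncol S"
  define M where "M = (\<lambda>c. if clr then clear_upto c (mark S) else mark S)"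
  let ?S = "\<lambda>c. S\<lparr>outp := outp S @ concat (map (word \<circ> e) [0..<c]), mark := M c, column := int c\<rparr>"
  have M0: "M 0 = mark S" by (auto simp: M_def clear_upto_def fun_eq_iff)
  \<comment> \<open>Erasure has reached only the columns strictly before \<open>c\<close>, so the
    cells under the heads are still intact.\<close>
  have reads_eq: "reads (conf (?S c)) i = reads (conf (S\<lparr>outp := u, column := int c\<rparr>)) i" if "i \<noteq> 1" for c i
    using that by (auto simp: conf_def read_def M_def clear_upto_def)
  have "runs (While in_columns (switch g V (\<lambda>v. emit 1 (word v)) \<then> advance clr))
      (conf (?S 0)) (?n * Suc (length V + (W + 1) + 1) + 1) (conf (?S ?n))"
  proof (rule runs_While[of _ _ "\<lambda>c. conf (?S c)"])
    fix c assume c: "c < ?n"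
    have gr: "g (reads (conf (?S c))) = e c"
      using e[OF c] g[of "reads (conf (?S c))"] reads_eq by metis
    let ?S' = "?S c\<lparr>outp := outp (?S c) @ word (e c)\<rparr>"
    have "runs (emit 1 (word (e c))) (conf (?S c)) (W + 1) (conf ?S')"
      by (rule runs_mono[OF runs_emit_outp]) (use length_num[of "e c"] e[OF c] in \<open>simp add: word_def\<close>)
    then have 1: "runs (switch g V (\<lambda>v. emit 1 (word v))) (conf (?S c)) (length V + (W + 1)) (conf ?S')"
      using gr e[OF c] by (intro runs_switch) auto
    have "runs (advance clr) (conf ?S') 1 (conf (?S (Suc c)))"
      unfolding advance_def
      by (rule runs_Op)
        (auto simp: conf_def fun_eq_iff act_def read_def M_def clear_upto_def)
    with 1 have "runs (switch g V (\<lambda>v. emit 1 (word v)) \<then> advance clr) (conf (?S c))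
        (length V + (W + 1) + 1) (conf (?S (Suc c)))"
      by (rule runs_Seq)
    with c show "in_columns (reads (conf (?S c))) \<and>
        runs (switch g V (\<lambda>v. emit 1 (word v)) \<then> advance clr) (conf (?S c))
          (length V + (W + 1) + 1) (conf (?S (Suc c)))"
      by simp
  qed simp
  moreover have "?S 0 = S" using column M0 by simp
  ultimately have 1: "runs (While in_columns (switch g V (\<lambda>v. emit 1 (word v)) \<then> advance clr))
      (conf S) (?n * Suc (length V + (W + 1) + 1) + 1) (conf (?S ?n))" by simp
  let ?S2 = "?S ?n\<lparr>outp := outp (?S ?n) @ [Hash]\<rparr>"
  have 2: "runs (emit 1 [Hash]) (conf (?S ?n)) (length [Hash] + 1) (conf ?S2)"
    by (rule runs_emit_outp)
  have "runs first_col (conf ?S2) (2 * ncol ?S2 + 3) (conf (?S2\<lparr>column := 0\<rparr>))"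
    by (rule runs_first_col) simp_all
  moreover have "?S2\<lparr>column := 0\<rparr> = S\<lparr>outp := outp S @ enc_row (map e [0..<?n]), mark := M ?n\<rparr>"
    using column by (simp add: enc_row_def)
  ultimately have 3: "runs first_col (conf ?S2) (2 * ?n + 3)
      (conf (S\<lparr>outp := outp S @ enc_row (map e [0..<?n]), mark := M ?n\<rparr>))" by simp
  have "?n * length V \<le> ?n * (2 * k + 1)" using V by (rule mult_le_mono2)
  then have "?n * Suc (length V + (W + 1) + 1) + 1 + (length [Hash] + 1 + (2 * ?n + 3)) \<le> Q * (?n + 1)"
    by (simp add: Q_def algebra_simps)
  with runs_Seq[OF 1 runs_Seq[OF 2 3]] show ?thesis
    unfolding row_prog_def M_def by (rule runs_mono)
qed

text \<open>The unary index is consumed while the column heads move along with the input head, so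
  they arrive at the column of the variable. Its unit row is then read off from the mark left
  there.\<close>

definition literal_prog :: "nat \<Rightarrow> bool \<Rightarrow> prog" where
  "literal_prog j b =
     mv {0} To_Right \<then> While (\<lambda>r. r 0 = One) (mv ({0} \<union> {4..}) To_Right) \<then>
     Op (\<lambda>r i. (if i = 5 then One else if i = 7 + j then sign_sym b else r i,
       if i = 0 then To_Right else Stay)) \<then>
     first_col \<then>
     row_prog (\<lambda>r. of_bool (r (7 + j) \<noteq> Blank)) [0, 1] False \<then>
     emit 2 (word (of_bool b))"

lemma runs_literal:
  assumes "column S = 0" "input_is S (enc_lit (i, b) @ v)" "i < ncol S"
    and "mark S j = (\<lambda>_. Blank)"
  shows "runs (literal_prog j b) (conf S) (2 * Q * (ncol S + 1))
    (conf (S\<lparr>pos := pos S + int (length (enc_lit (i, b))),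
      outp := outp S @ enc_row (map (\<lambda>x. of_bool (x = i)) [0..<ncol S]),
      targ := targ S @ word (of_bool b),
      used := (used S)(int i := One),
      mark := (mark S)(j := (\<lambda>_. Blank)(int i := sign_sym b))\<rparr>))"
proof -
  let ?n = "ncol S"
  have inp: "inp S (pos S + x) = contents (enc_lit (i, b) @ v) x" if "0 \<le> x" for x
    using assms(2) that by (simp add: input_is_def)
  let ?S = "\<lambda>c. S\<lparr>pos := pos S + 1 + int c, column := int c\<rparr>"
  have "?S 0 = S\<lparr>pos := pos S + 1\<rparr>" using assms(1) by simp
  then have 1: "runs (mv {0} To_Right) (conf S) 1 (conf (?S 0))"
    using runs_mv_inp[of S] by simp
  have 2: "runs (While (\<lambda>r. r 0 = One) (mv ({0} \<union> {4..}) To_Right)) (conf (?S 0)) (i * Suc 1 + 1) (conf (?S i))"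
  proof (rule runs_While[of _ _ "\<lambda>c. conf (?S c)"])
    fix c assume "c < i"
    then have "reads (conf (?S c)) 0 = One"
      using inp[of "1 + int c"] by (simp add: enc_lit_def contents_def nth_append add.assoc nat_add_distrib)
    moreover have "runs (mv ({0} \<union> {4..}) To_Right) (conf (?S c)) 1 (conf (?S (Suc c)))"
      by (rule runs_mv) (auto simp: conf_def fun_eq_iff)
    ultimately show "reads (conf (?S c)) 0 = One \<and>
      runs (mv ({0} \<union> {4..}) To_Right) (conf (?S c)) 1 (conf (?S (Suc c)))" ..
  next
    show "\<not> reads (conf (?S i)) 0 = One"
      using inp[of "1 + int i"] by (simp add: enc_lit_def contents_def nth_append add.assoc nat_add_distrib)
  qed
  define S3 where "S3 = S\<lparr>pos := pos S + int (length (enc_lit (i, b))),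
    used := (used S)(int i := One), mark := (mark S)(j := (\<lambda>_. Blank)(int i := sign_sym b)), column := int i\<rparr>"
  \<comment> \<open>The input head is on the comma; the step that sets the marks also moves past
    it.\<close>
  have 3: "runs (Op (\<lambda>r i. (if i = 5 then One else if i = 7 + j then sign_sym b else r i,
       if i = 0 then To_Right else Stay))) (conf (?S i)) 1 (conf S3)"
    using assms(4) by (intro runs_Op)
      (auto simp: S3_def conf_def fun_eq_iff act_def read_def enc_lit_def)
  have 4: "runs first_col (conf S3) (2 * ?n + 3) (conf (S3\<lparr>column := 0\<rparr>))"
    using runs_first_col[of S3] assms(3) by (simp add: S3_def)
  define S5 where "S5 = S3\<lparr>column := 0, outp := outp S @ enc_row (map (\<lambda>x. of_bool (x = i)) [0..<?n]),
    mark := mark S3\<rparr>"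
  have "runs (row_prog (\<lambda>r. of_bool (r (7 + j) \<noteq> Blank)) [0, 1] False) (conf (S3\<lparr>column := 0\<rparr>)) (Q * (ncol (S3\<lparr>column := 0\<rparr>) + 1))
    (conf (S3\<lparr>column := 0, outp := outp (S3\<lparr>column := 0\<rparr>) @ enc_row (map (\<lambda>x. of_bool (x = i)) [0..<ncol (S3\<lparr>column := 0\<rparr>)]),
      mark := if False then clear_upto (ncol (S3\<lparr>column := 0\<rparr>)) (mark (S3\<lparr>column := 0\<rparr>)) else mark (S3\<lparr>column := 0\<rparr>)\<rparr>))"
  proof (rule runs_row)
    fix c
    show "of_bool (reads (conf (S3\<lparr>column := 0, outp := [], column := int c\<rparr>)) (7 + j) \<noteq> Blank) = (of_bool (c = i) :: int) \<and>
        of_bool (c = i) \<in> set [0 :: int, 1] \<and> \<bar>of_bool (c = i) :: int\<bar> \<le> int k"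
      using k by (simp add: S3_def sign_sym_def)
  qed (use k in auto)
  then have 5: "runs (row_prog (\<lambda>r. of_bool (r (7 + j) \<noteq> Blank)) [0, 1] False) (conf (S3\<lparr>column := 0\<rparr>)) (Q * (?n + 1)) (conf S5)"
    by (simp add: S5_def S3_def)
  have 6: "runs (emit 2 (word (of_bool b))) (conf S5) (W + 1)
      (conf (S5\<lparr>targ := targ S5 @ word (of_bool b)\<rparr>))"
    by (rule runs_mono[OF runs_emit_targ])
      (use k length_num[of "of_bool b"] in \<open>auto simp: word_def\<close>)
  have fin: "S5\<lparr>targ := targ S5 @ word (of_bool b)\<rparr> = S\<lparr>pos := pos S + int (length (enc_lit (i, b))),
      outp := outp S @ enc_row (map (\<lambda>x. of_bool (x = i)) [0..<ncol S]),
      targ := targ S @ word (of_bool b),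
      used := (used S)(int i := One),
      mark := (mark S)(j := (\<lambda>_. Blank)(int i := sign_sym b))\<rparr>"
    using assms(1) by (simp add: S5_def S3_def)
  have "1 + (i * Suc 1 + 1 + (1 + (2 * ?n + 3 + (Q * (?n + 1) + (W + 1))))) \<le> 2 * Q * (?n + 1)"
    using assms(3) by (simp add: Q_def algebra_simps)
  with runs_Seq[OF 1 runs_Seq[OF 2 runs_Seq[OF 3 runs_Seq[OF 4 runs_Seq[OF 5 6]]]]]
  show ?thesis
    unfolding literal_prog_def fin by (rule runs_mono)
qed

text \<open>The number \<open>v\<close> of negations seen so far is part of the control state.\<close>

primrec literals_prog :: "nat \<Rightarrow> nat \<Rightarrow> prog" where
  "literals_prog 0 v = emit 2 (word (1 - int v))"
| "literals_prog (Suc m) v =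
     Cond (\<lambda>r. r 0 = One)
       (literal_prog (k - Suc m) True \<then> literals_prog m v)
       (literal_prog (k - Suc m) False \<then> literals_prog m (Suc v))"

lemma markers_snoc:
  "(markers c)(length c := (\<lambda>_. Blank)(int (fst l) := sign_sym (snd l))) = markers (c @ [l])"
  by (auto simp: markers_def fun_eq_iff nth_append)

lemma occupied_insert: "(occupied U)(int i := One) = occupied (insert i U)"
  by (auto simp: occupied_def fun_eq_iff)

text \<open>The literals \<open>c\<close> already read determine the next mark tape, with index
  \<open>length c\<close>, and the control parameter \<open>negs c\<close>; the induction runs over
  the rest \<open>c'\<close>.\<close>

lemma runs_literals:
  assumes "length c + length c' = k" "column S = 0"
    and "input_is S (concat (map enc_lit c') @ v)"
    and "\<forall>l\<in>set c'. fst l < ncol S"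
    and "mark S = markers c" "used S = occupied U"
  shows "runs (literals_prog (length c') (negs c)) (conf S) (3 * (length c' + 1) * (Q * (ncol S + 1)))
    (conf (S\<lparr>pos := pos S + int (length (concat (map enc_lit c'))),
      outp := outp S @ concat (map (\<lambda>l. enc_row (map (\<lambda>x. of_bool (x = fst l)) [0..<ncol S])) c'),
      targ := targ S @ concat (map (\<lambda>l. word (of_bool (snd l))) c') @ word (1 - int (negs (c @ c'))),
      used := occupied (U \<union> fst ` set c'),
      mark := markers (c @ c')\<rparr>))"
  using assms
proof (induction c' arbitrary: c S U)
  case Nil
  have "negs c \<le> k" using Nil.prems(1) by (simp add: negs_def le_trans[OF length_filter_le])
  then have "length (word (1 - int (negs c))) \<le> W"
    unfolding word_def using k by (intro length_num) auto
  then have "length (word (1 - int (negs c))) + 1 \<le> 3 * (0 + 1) * (Q * (ncol S + 1))"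
    by (simp add: Q_def algebra_simps)
  with runs_emit_targ[of "word (1 - int (negs c))" S] have run:
    "runs (emit 2 (word (1 - int (negs c)))) (conf S) (3 * (0 + 1) * (Q * (ncol S + 1)))
      (conf (S\<lparr>targ := targ S @ word (1 - int (negs c))\<rparr>))"
    by (rule runs_mono)
  show ?case (is "runs _ _ _ (conf ?S)")
  proof -
    have "?S = S\<lparr>targ := targ S @ word (1 - int (negs c))\<rparr>"
      using Nil.prems(5,6) by (cases S) simp
    with run show ?thesis by simp
  qed
next
  case (Cons l c')
  obtain i b where l: "l = (i, b)" by (cases l)
  let ?n = "ncol S"
  define S1 where "S1 = S\<lparr>pos := pos S + int (length (enc_lit l)),
      outp := outp S @ enc_row (map (\<lambda>x. of_bool (x = fst l)) [0..<?n]),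
      targ := targ S @ word (of_bool b),
      used := occupied (insert i U),
      mark := markers (c @ [l])\<rparr>"
  have S: "input_is S (enc_lit l @ concat (map enc_lit c') @ v)" using Cons.prems(3) by simp
  have "mark S (length c) = (\<lambda>_. Blank)" using Cons.prems(5) by (simp add: markers_def fun_eq_iff)
  from runs_literal[OF Cons.prems(2) S[unfolded l] _ this]
  have lit: "runs (literal_prog (length c) b) (conf S) (2 * Q * (?n + 1)) (conf S1)"
    using Cons.prems(4) markers_snoc[of c l] unfolding Cons.prems(5,6) occupied_insert
    by (simp add: S1_def l)
  have inp: "input_is S1 (concat (map enc_lit c') @ v)"
    using input_is_append[OF S] by (simp add: S1_def)
  have "runs (literals_prog (length c') (negs (c @ [l]))) (conf S1) (3 * (length c' + 1) * (Q * (ncol S1 + 1)))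
    (conf (S1\<lparr>pos := pos S1 + int (length (concat (map enc_lit c'))),
      outp := outp S1 @ concat (map (\<lambda>l. enc_row (map (\<lambda>x. of_bool (x = fst l)) [0..<ncol S1])) c'),
      targ := targ S1 @ concat (map (\<lambda>l. word (of_bool (snd l))) c') @ word (1 - int (negs ((c @ [l]) @ c'))),
      used := occupied (insert i U \<union> fst ` set c'),
      mark := markers ((c @ [l]) @ c')\<rparr>))"
    by (rule Cons.IH) (use Cons.prems inp in \<open>auto simp: S1_def\<close>)
  then have rest: "runs (literals_prog (length c') (negs (c @ [l]))) (conf S1) (3 * (length c' + 1) * (Q * (?n + 1)))
    (conf (S\<lparr>pos := pos S + int (length (concat (map enc_lit (l # c')))),
      outp := outp S @ concat (map (\<lambda>l. enc_row (map (\<lambda>x. of_bool (x = fst l)) [0..<?n])) (l # c')),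
      targ := targ S @ concat (map (\<lambda>l. word (of_bool (snd l))) (l # c')) @ word (1 - int (negs (c @ l # c'))),
      used := occupied (U \<union> fst ` set (l # c')),
      mark := markers (c @ l # c')\<rparr>))"
    by (simp add: S1_def l add.assoc)
  have j: "k - Suc (length c') = length c" using Cons.prems(1) by simp
  have inp0: "inp S (pos S) = sign_sym b" using input_isD[OF S] by (simp add: enc_lit_def l)
  have time: "Suc (2 * Q * (?n + 1) + 3 * (length c' + 1) * (Q * (?n + 1))) \<le>
      3 * (length (l # c') + 1) * (Q * (?n + 1))"
    by (simp add: Q_def algebra_simps)
  note seq = runs_Seq[OF lit rest]
  show ?case (is "runs _ _ _ ?\<sigma>")
  proof (rule runs_mono[OF _ time], cases b)
    case True
    then have "negs (c @ [l]) = negs c" by (simp add: negs_def l)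
    moreover have "reads (conf S) 0 = One" using True inp0 by (simp add: sign_sym_def)
    ultimately show "runs (literals_prog (length (l # c')) (negs c)) (conf S)
        (Suc (2 * Q * (?n + 1) + 3 * (length c' + 1) * (Q * (?n + 1)))) ?\<sigma>"
      using seq True unfolding length_Cons literals_prog.simps j by (intro runs_CondT) simp_all
  next
    case False
    then have "negs (c @ [l]) = Suc (negs c)" by (simp add: negs_def l)
    moreover have "\<not> reads (conf S) 0 = One" using False inp0 by (simp add: sign_sym_def)
    ultimately show "runs (literals_prog (length (l # c')) (negs c)) (conf S)
        (Suc (2 * Q * (?n + 1) + 3 * (length c' + 1) * (Q * (?n + 1)))) ?\<sigma>"
      using seq False unfolding length_Cons literals_prog.simps j by (intro runs_CondF) simp_all
  qed
qed

end

text \<open>The right-hand side is what the machine sees in a single column, blanks counting as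
  zero.\<close>

lemma clause_coeff_eq_sum: "clause_coeff c x = (\<Sum>j<length c. sign_val (markers c j (int x)))"
proof -
  have "clause_coeff c x = (\<Sum>j<length c. case c ! j of (i, b) \<Rightarrow> if i = x then if b then 1 else - 1 else 0)"
    by (simp add: clause_coeff_def sum_list_sum_nth atLeast0LessThan)
  also have "\<dots> = (\<Sum>j<length c. sign_val (markers c j (int x)))"
    by (intro sum.cong) (auto simp: markers_def sign_val_def sign_sym_def split: prod.splits)
  finally show ?thesis .
qed

text \<open>Hence a table of \<open>2 * k + 1\<close> values covers all entries of the last row of a
  clause.\<close>

lemma abs_clause_coeff: "\<bar>clause_coeff c x\<bar> \<le> int (length c)"
proof -
  have "\<bar>clause_coeff c x\<bar> \<le> (\<Sum>j<length c. \<bar>sign_val (markers c j (int x))\<bar>)"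
    unfolding clause_coeff_eq_sum by (rule sum_abs)
  also have "\<dots> \<le> (\<Sum>j<length c. 1)"
    by (intro sum_mono) (auto simp: sign_val_def)
  finally show ?thesis by simp
qed

lemma clear_markers: "\<forall>l\<in>set c. fst l < n \<Longrightarrow> clear_upto n (markers c) = markers []"
  by (auto simp: clear_upto_def markers_def fun_eq_iff)

lemma vars_snoc: "vars (cs @ [c]) = vars cs \<union> fst ` set c"
  by (auto simp: vars_def)

context number_encoding
begin

definition enc_rows :: "int list list \<Rightarrow> sym list" where
  "enc_rows R = concat (map enc_row R)"

definition enc_words :: "int list \<Rightarrow> sym list" where
  "enc_words t = concat (map word t)"

lemma enc_rows_append [simp]: "enc_rows (R @ R') = enc_rows R @ enc_rows R'"
  by (simp add: enc_rows_def)

lemma enc_words_append [simp]: "enc_words (t @ t') = enc_words t @ enc_words t'"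
  by (simp add: enc_words_def)

lemma enc_rows_Nil [simp]: "enc_rows [] = []"
  by (simp add: enc_rows_def)

lemma enc_words_Nil [simp]: "enc_words [] = []"
  by (simp add: enc_words_def)

definition clause_prog :: prog where
  "clause_prog = literals_prog k 0 \<then> mv {0} To_Right \<then>
     row_prog (\<lambda>r. \<Sum>j<k. sign_val (r (7 + j))) (map (\<lambda>i. int i - int k) [0..<2 * k + 1]) True \<then>
     incr 3"

lemma runs_clause:
  assumes "column S = 0" "input_is S (enc_clause c @ v)" "length c = k"
    and "\<forall>l\<in>set c. fst l < ncol S"
    and "mark S = markers []" "used S = occupied U"
  shows "runs clause_prog (conf S) ((4 * k + 5) * (Q * (ncol S + 1)) + 4 * count S)
    (conf (S\<lparr>pos := pos S + int (length (enc_clause c)),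
      outp := outp S @ enc_rows (clause_rows (ncol S) c),
      targ := targ S @ enc_words (clause_targets c),
      count := Suc (count S),
      used := occupied (U \<union> fst ` set c)\<rparr>))"
proof -
  let ?n = "ncol S"
  define S1 where "S1 = S\<lparr>pos := pos S + int (length (concat (map enc_lit c))),
      outp := outp S @ concat (map (\<lambda>l. enc_row (map (\<lambda>x. of_bool (x = fst l)) [0..<?n])) c),
      targ := targ S @ concat (map (\<lambda>l. word (of_bool (snd l))) c) @ word (1 - int (negs c)),
      used := occupied (U \<union> fst ` set c),
      mark := markers c\<rparr>"
  define S2 where "S2 = S1\<lparr>pos := pos S1 + 1\<rparr>"
  have "negs [] = 0" by (simp add: negs_def)
  then have 1: "runs (literals_prog k 0) (conf S) (3 * (k + 1) * (Q * (?n + 1))) (conf S1)"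
    using runs_literals[of "[]" c S "Semicolon # v" U] assms
    by (simp add: enc_clause_eq S1_def)
  have 2: "runs (mv {0} To_Right) (conf S1) 1 (conf S2)"
    unfolding S2_def by (rule runs_mv_inp)
  have 3: "runs (row_prog (\<lambda>r. \<Sum>j<k. sign_val (r (7 + j))) (map (\<lambda>i. int i - int k) [0..<2 * k + 1]) True)
    (conf S2) (Q * (ncol S2 + 1))
    (conf (S2\<lparr>outp := outp S2 @ enc_row (map (clause_coeff c) [0..<ncol S2]),
      mark := if True then clear_upto (ncol S2) (mark S2) else mark S2\<rparr>))"
  proof (rule runs_row)
    show "column S2 = 0" using assms(1) by (simp add: S2_def S1_def)
  next
    fix x
    \<comment> \<open>The shift by \<open>k\<close> turns the coefficient into an index of the
      table.\<close>
    have "clause_coeff c x = int (nat (clause_coeff c x + int k)) - int k" "nat (clause_coeff c x + int k) < 2 * k + 1"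
      using abs_clause_coeff[of c x] assms(3) by auto
    then have "clause_coeff c x \<in> set (map (\<lambda>i. int i - int k) [0..<2 * k + 1])"
      by (force simp del: upt_Suc)
    then show "(\<Sum>j<k. sign_val (reads (conf (S2\<lparr>outp := [], column := int x\<rparr>)) (7 + j))) = clause_coeff c x \<and>
      clause_coeff c x \<in> set (map (\<lambda>i. int i - int k) [0..<2 * k + 1]) \<and> \<bar>clause_coeff c x\<bar> \<le> int k"
      using abs_clause_coeff[of c x] assms(3) by (simp add: S2_def S1_def clause_coeff_eq_sum)
  qed simp_all
  define S3 where "S3 = S2\<lparr>outp := outp S2 @ enc_row (map (clause_coeff c) [0..<ncol S2]), mark := markers []\<rparr>"
  have "clear_upto (ncol S2) (mark S2) = markers []"
    using assms(4) clear_markers by (simp add: S2_def S1_def)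
  with 3 have 3: "runs (row_prog (\<lambda>r. \<Sum>j<k. sign_val (r (7 + j))) (map (\<lambda>i. int i - int k) [0..<2 * k + 1]) True)
    (conf S2) (Q * (?n + 1)) (conf S3)"
    by (simp add: S3_def S2_def S1_def)
  have 4: "runs (incr 3) (conf S3) (4 * count S + 8) (conf (S3\<lparr>count := Suc (count S)\<rparr>))"
    using runs_incr_count[of S3] by (simp add: S3_def S2_def S1_def)
  have fin: "S3\<lparr>count := Suc (count S)\<rparr> = S\<lparr>pos := pos S + int (length (enc_clause c)),
      outp := outp S @ enc_rows (clause_rows (ncol S) c),
      targ := targ S @ enc_words (clause_targets c),
      count := Suc (count S),
      used := occupied (U \<union> fst ` set c)\<rparr>"
    using assms(5) by (intro st.equality)
      (simp_all add: S3_def S2_def S1_def enc_clause_eq enc_rows_def enc_words_def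
        clause_rows_def clause_targets_def o_def)
  have "3 * (k + 1) * (Q * (?n + 1)) + (1 + (Q * (?n + 1) + (4 * count S + 8))) \<le>
      (4 * k + 5) * (Q * (?n + 1)) + 4 * count S"
    by (simp add: Q_def algebra_simps)
  with runs_Seq[OF 1 runs_Seq[OF 2 runs_Seq[OF 3 4]]] show ?thesis
    unfolding clause_prog_def fin by (rule runs_mono)
qed

definition clauses_prog :: prog where
  "clauses_prog = While (\<lambda>r. r 0 \<noteq> Blank) clause_prog"

lemma runs_clauses:
  assumes "column S = 0" "input_is S (concat (map enc_clause cs))"
    and "\<forall>c\<in>set cs. length c = k \<and> (\<forall>l\<in>set c. fst l < ncol S)"
    and "mark S = markers []" "used S = occupied {}" "count S = 0"
  shows "runs clauses_prog (conf S)
    (length cs * Suc ((4 * k + 5) * (Q * (ncol S + 1)) + 4 * length cs) + 1)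
    (conf (S\<lparr>pos := pos S + int (length (concat (map enc_clause cs))),
      outp := outp S @ enc_rows (concat (map (clause_rows (ncol S)) cs)),
      targ := targ S @ enc_words (concat (map clause_targets cs)),
      count := length cs,
      used := occupied (vars cs)\<rparr>))"
proof -
  let ?n = "ncol S"
  define s where "s = (\<lambda>i. S\<lparr>pos := pos S + int (length (concat (map enc_clause (take i cs)))),
      outp := outp S @ enc_rows (concat (map (clause_rows ?n) (take i cs))),
      targ := targ S @ enc_words (concat (map clause_targets (take i cs))),
      count := i,
      used := occupied (vars (take i cs))\<rparr>)"
  have inp: "input_is (s i) (concat (map enc_clause (drop i cs)))" for i
  proof -
    have "concat (map enc_clause cs) =
      concat (map enc_clause (take i cs)) @ concat (map enc_clause (drop i cs))"
      by (metis append_take_drop_id concat_append map_append)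
    from input_is_append[OF assms(2)[unfolded this]] show ?thesis by (simp add: s_def)
  qed
  have "runs clauses_prog (conf (s 0))
    (length cs * Suc ((4 * k + 5) * (Q * (?n + 1)) + 4 * length cs) + 1) (conf (s (length cs)))"
    unfolding clauses_prog_def
  proof (rule runs_While[of _ _ "\<lambda>i. conf (s i)"])
    fix i assume i: "i < length cs"
    define c where "c = cs ! i"
    have c: "length c = k" "\<forall>l\<in>set c. fst l < ?n" using assms(3) i by (auto simp: c_def)
    have inp_i: "input_is (s i) (enc_clause c @ concat (map enc_clause (drop (Suc i) cs)))"
      using inp[of i] i by (simp add: c_def flip: Cons_nth_drop_Suc)
    obtain l c' where "c = l # c'" using c(1) k by (cases c) auto
    then have "reads (conf (s i)) 0 \<noteq> Blank"
      using input_isD[OF inp_i] by (simp add: enc_clause_eq enc_lit_def sign_sym_def)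
    moreover have "runs clause_prog (conf (s i)) ((4 * k + 5) * (Q * (?n + 1)) + 4 * length cs) (conf (s (Suc i)))"
    proof -
      have "runs clause_prog (conf (s i)) ((4 * k + 5) * (Q * (ncol (s i) + 1)) + 4 * count (s i))
        (conf (s i\<lparr>pos := pos (s i) + int (length (enc_clause c)),
          outp := outp (s i) @ enc_rows (clause_rows (ncol (s i)) c),
          targ := targ (s i) @ enc_words (clause_targets c),
          count := Suc (count (s i)),
          used := occupied (vars (take i cs) \<union> fst ` set c)\<rparr>))"
        by (rule runs_clause[OF _ inp_i]) (use assms c in \<open>simp_all add: s_def\<close>)
      moreover have "s i\<lparr>pos := pos (s i) + int (length (enc_clause c)),
          outp := outp (s i) @ enc_rows (clause_rows (ncol (s i)) c),
          targ := targ (s i) @ enc_words (clause_targets c),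
          count := Suc (count (s i)),
          used := occupied (vars (take i cs) \<union> fst ` set c)\<rparr> = s (Suc i)"
        using i by (simp add: s_def take_Suc_conv_app_nth vars_snoc flip: c_def)
      ultimately have "runs clause_prog (conf (s i)) ((4 * k + 5) * (Q * (?n + 1)) + 4 * i) (conf (s (Suc i)))"
        by (simp add: s_def)
      then show ?thesis by (rule runs_mono) (use i in simp)
    qed
    ultimately show "reads (conf (s i)) 0 \<noteq> Blank \<and>
      runs clause_prog (conf (s i)) ((4 * k + 5) * (Q * (?n + 1)) + 4 * length cs) (conf (s (Suc i)))" ..
  next
    show "\<not> reads (conf (s (length cs))) 0 \<noteq> Blank"
      using input_isD[OF inp[of "length cs"]] by simp
  qed
  moreover have "s 0 = S"
    using assms(5,6) by (intro st.equality) (simp_all add: s_def vars_def)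
  ultimately show ?thesis by (simp add: s_def)
qed

text \<open>A single pass over the unary \<open>n\<close> writes both the beginning of the output
  and the ones on tape 4 that delimit the columns.\<close>

definition prefix_prog :: prog where
  "prefix_prog =
     While (\<lambda>r. r 0 = One)
       (Op (\<lambda>r i. (if i = 1 \<or> i = 4 then One else r i, if i = 2 \<or> i = 3 then Stay else To_Right))) \<then>
     mv {0} To_Right \<then> emit 1 [Hash] \<then> first_col"

definition start :: "sym list \<Rightarrow> st" where
  "start w = \<lparr>inp = contents w, pos = 0, outp = [], targ = [], count = 0, ncol = 0,
     used = occupied {}, diag = (\<lambda>_. Blank), off = 0, mark = markers [], column = 0\<rparr>"

lemma conf_start: "conf (start w) i = (if i = 0 then (contents w, 0) else (contents [], 0))"
  by (auto simp: conf_def start_def occupied_def markers_def fun_eq_iff)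

lemma runs_prefix:
  assumes "w = replicate n One @ Hash # v"
  shows "runs prefix_prog (conf (start w)) (4 * n + 7)
    (conf (start w\<lparr>pos := int n + 1, outp := replicate n One @ [Hash], ncol := n\<rparr>))"
proof -
  let ?p = "Op (\<lambda>r i. (if i = 1 \<or> i = 4 then One else r i, if i = 2 \<or> i = 3 then Stay else To_Right))"
  let ?S = "\<lambda>i. start w\<lparr>pos := int i, outp := replicate i One, ncol := i, column := int i\<rparr>"
  have 1: "runs (While (\<lambda>r. r 0 = One) ?p) (conf (?S 0)) (n * Suc 1 + 1) (conf (?S n))"
  proof (rule runs_While[of _ _ "\<lambda>i. conf (?S i)"])
    fix i assume i: "i < n"
    have "runs ?p (conf (?S i)) 1 (conf (?S (Suc i)))"
      by (rule runs_Op)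
        (auto simp: conf_def start_def fun_eq_iff act_def read_def occupied_def markers_def
          contents_replicate simp del: replicate.simps)
    moreover have "reads (conf (?S i)) 0 = One"
      using i by (simp add: start_def assms contents_def nth_append)
    ultimately show "reads (conf (?S i)) 0 = One \<and> runs ?p (conf (?S i)) 1 (conf (?S (Suc i)))" by simp
  next
    show "\<not> reads (conf (?S n)) 0 = One"
      by (simp add: start_def assms contents_def nth_append)
  qed
  have S0: "?S 0 = start w" by (simp add: start_def)
  let ?S1 = "?S n\<lparr>pos := pos (?S n) + 1\<rparr>"
  have 2: "runs (mv {0} To_Right) (conf (?S n)) 1 (conf ?S1)" by (rule runs_mv_inp)
  let ?S2 = "?S1\<lparr>outp := outp ?S1 @ [Hash]\<rparr>"
  have 3: "runs (emit 1 [Hash]) (conf ?S1) (length [Hash] + 1) (conf ?S2)" by (rule runs_emit_outp)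
  have 4: "runs first_col (conf ?S2) (2 * ncol ?S2 + 3) (conf (?S2\<lparr>column := 0\<rparr>))"
    by (rule runs_first_col) simp_all
  have fin: "?S2\<lparr>column := 0\<rparr> = start w\<lparr>pos := int n + 1, outp := replicate n One @ [Hash], ncol := n\<rparr>"
    by (intro st.equality) (simp_all add: start_def)
  have t: "n * Suc 1 + 1 + (1 + (length [Hash] + 1 + (2 * ncol ?S2 + 3))) \<le> 4 * n + 7"
    by simp
  show ?thesis
    using runs_mono[OF runs_Seq[OF 1 runs_Seq[OF 2 runs_Seq[OF 3 4]]] t]
    unfolding prefix_prog_def fin S0 .
qed

text \<open>The head on the tape with a single marker lags behind by the index of the current row, so
  that it sees the marker exactly in the diagonal column.\<close>

definition unused_prog :: prog where
  "unused_prog =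
     Op (\<lambda>r i. (if i = 6 then One else r i, Stay)) \<then> rewind 0 \<then>
     While (\<lambda>r. r 0 = One)
       (row_prog (\<lambda>r. of_bool (r 6 = One \<and> r 5 = Blank)) [0, 1] False \<then> emit 2 (word 0) \<then>
        mv {0} To_Right \<then> mv {6} To_Left)"

text \<open>The final state stays existential: the programs that follow depend only on the output,
  the targets and the counter.\<close>

lemma runs_unused:
  assumes "column S = 0" "off S = 0" "diag S = (\<lambda>_. Blank)" "used S = occupied U"
    and "inp S = contents w" "w = replicate n One @ Hash # v" "ncol S = n" "Blank \<notin> set w"
    and "0 \<le> pos S" "pos S \<le> int (length w)"
  shows "\<exists>S'. runs unused_prog (conf S) (2 * length w + 5 + n * (2 * Q * (n + 1))) (conf S') \<and>
      outp S' = outp S @ enc_rows (map (unused_row n U) [0..<n]) \<and>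
      targ S' = targ S @ enc_words (replicate n 0) \<and> count S' = count S"
proof -
  define S1 where "S1 = S\<lparr>diag := contents [One]\<rparr>"
  have 1: "runs (Op (\<lambda>r i. (if i = 6 then One else r i, Stay))) (conf S) 1 (conf S1)"
    using assms(1-3) by (intro runs_Op)
      (auto simp: S1_def conf_def fun_eq_iff act_def read_def contents_def)
  \<comment> \<open>Back at its beginning, the input offers its \<open>n\<close> leading ones once
    more, now as a loop counter for the rows.\<close>
  have 2: "runs (rewind 0) (conf S1) (2 * length w + 3) (conf (S1\<lparr>pos := 0\<rparr>))"
  proof -
    have "(conf S1)(0 := (contents w, 0)) = conf (S1\<lparr>pos := 0\<rparr>)"
      using assms(5) by (auto simp: conf_def S1_def fun_eq_iff)
    then show ?thesis
      using runs_rewind[of "conf S1" 0 w "nat (pos S)"] assms by (simp add: conf_def S1_def)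
  qed
  define s where "s = (\<lambda>i. S1\<lparr>pos := int i,
      outp := outp S @ enc_rows (map (unused_row n U) [0..<i]),
      targ := targ S @ enc_words (replicate i 0), off := i\<rparr>)"
  let ?row_prog = "row_prog (\<lambda>r. of_bool (r 6 = One \<and> r 5 = Blank)) [0, 1] False"
  let ?p = "?row_prog \<then> emit 2 (word 0) \<then> mv {0} To_Right \<then> mv {6} To_Left"
  have 3: "runs (While (\<lambda>r. r 0 = One) ?p) (conf (s 0))
      (n * Suc (Q * (n + 1) + (W + 1 + (1 + 1))) + 1) (conf (s n))"
  proof (rule runs_While[of _ _ "\<lambda>i. conf (s i)"])
    fix i assume i: "i < n"
    have "runs ?row_prog (conf (s i)) (Q * (ncol (s i) + 1))
      (conf (s i\<lparr>outp := outp (s i) @ enc_row (map (\<lambda>x. of_bool (x = i \<and> i \<notin> U)) [0..<ncol (s i)]),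
        mark := if False then clear_upto (ncol (s i)) (mark (s i)) else mark (s i)\<rparr>))"
    proof (rule runs_row)
      show "column (s i) = 0" using assms(1) by (simp add: s_def S1_def)
    next
      fix x
      have "contents [One] (int x - int i) = One \<longleftrightarrow> x = i"
        by (auto simp: contents_def)
      then have "(x = i \<and> i \<notin> U) = (diag S1 (int x - int i) = One \<and> used S1 (int x) = Blank)"
        using assms(4) by (auto simp: S1_def occupied_def)
      then show "of_bool (reads (conf (s i\<lparr>outp := [], column := int x\<rparr>)) 6 = One \<and>
            reads (conf (s i\<lparr>outp := [], column := int x\<rparr>)) 5 = Blank) =
          (of_bool (x = i \<and> i \<notin> U) :: int) \<and>
          of_bool (x = i \<and> i \<notin> U) \<in> set [0 :: int, 1] \<and> \<bar>of_bool (x = i \<and> i \<notin> U) :: int\<bar> \<le> int k"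
        using k by (simp add: s_def)
    qed (use k in auto)
    moreover define S2 where "S2 = s i\<lparr>outp := outp (s i) @ enc_row (unused_row n U i)\<rparr>"
    ultimately have r1: "runs ?row_prog (conf (s i)) (Q * (n + 1)) (conf S2)"
      using assms(7) by (simp add: S2_def s_def S1_def unused_row_def)
    have r2: "runs (emit 2 (word 0)) (conf S2) (W + 1) (conf (S2\<lparr>targ := targ S2 @ word 0\<rparr>))"
      by (rule runs_mono[OF runs_emit_targ]) (use length_num[of 0] in \<open>simp add: word_def\<close>)
    have r3: "runs (mv {0} To_Right) (conf (S2\<lparr>targ := targ S2 @ word 0\<rparr>)) 1
      (conf (S2\<lparr>targ := targ S2 @ word 0, pos := int (Suc i)\<rparr>))"
      using runs_mv_inp[of "S2\<lparr>targ := targ S2 @ word 0\<rparr>"] by (simp add: S2_def s_def add.commute)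
    have "s (Suc i) = S2\<lparr>targ := targ S2 @ word 0, pos := int (Suc i), off := Suc i\<rparr>"
      by (intro st.equality)
        (simp_all add: S2_def s_def enc_rows_def enc_words_def replicate_append_same[symmetric])
    then have r4: "runs (mv {6} To_Left) (conf (S2\<lparr>targ := targ S2 @ word 0, pos := int (Suc i)\<rparr>)) 1
      (conf (s (Suc i)))"
      by (intro runs_mv) (auto simp: conf_def fun_eq_iff S2_def s_def)
    have "reads (conf (s i)) 0 = One"
      using i assms(5,6) by (simp add: s_def S1_def contents_def nth_append)
    with runs_Seq[OF r1 runs_Seq[OF r2 runs_Seq[OF r3 r4]]]
    show "reads (conf (s i)) 0 = One \<and>
        runs ?p (conf (s i)) (Q * (n + 1) + (W + 1 + (1 + 1))) (conf (s (Suc i)))" by simp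
  next
    show "\<not> reads (conf (s n)) 0 = One"
      using assms(5,6) by (simp add: s_def S1_def contents_def nth_append)
  qed
  have s0: "S1\<lparr>pos := 0\<rparr> = s 0"
    using assms(2) by (intro st.equality) (simp_all add: s_def S1_def)
  have "Suc (Q * (n + 1) + (W + 1 + (1 + 1))) \<le> 2 * Q * (n + 1)"
    by (simp add: Q_def algebra_simps)
  then have "n * Suc (Q * (n + 1) + (W + 1 + (1 + 1))) \<le> n * (2 * Q * (n + 1))"
    by (rule mult_le_mono2)
  then have t: "1 + (2 * length w + 3 + (n * Suc (Q * (n + 1) + (W + 1 + (1 + 1))) + 1)) \<le>
      2 * length w + 5 + n * (2 * Q * (n + 1))" by simp
  have "runs unused_prog (conf S) (2 * length w + 5 + n * (2 * Q * (n + 1))) (conf (s n))"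
    using runs_mono[OF runs_Seq[OF 1 runs_Seq[OF 2[unfolded s0] 3]] t] unfolding unused_prog_def .
  then show ?thesis by (intro exI[of _ "s n"]) (simp add: s_def S1_def)
qed

text \<open>The counter is rewound after each copy because the number of clauses may occur in more
  than one coefficient of the radius.\<close>

definition radius_prog :: prog where
  "radius_prog = emit 1 w0 \<then> foldr (\<lambda>w p. copy 3 1 \<then> rewind 3 \<then> emit 1 w \<then> p) ws skip"

lemma runs_radius:
  assumes "\<sigma> 1 = (contents u, int (length u))" "\<sigma> 3 = (contents (enc_nat m), 0)" "0 < m"
  shows "\<exists>\<sigma>'. runs radius_prog \<sigma> (length w0 + 2 + (\<Sum>w\<leftarrow>ws. 4 * m + 5 + length w)) \<sigma>' \<and>
    fst (\<sigma>' 1) = contents (u @ enc_num (rad m))"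
proof -
  have *: "\<exists>\<sigma>'. runs (foldr (\<lambda>w p. copy 3 1 \<then> rewind 3 \<then> emit 1 w \<then> p) xs skip) \<sigma>
      (1 + (\<Sum>w\<leftarrow>xs. 4 * m + 5 + length w)) \<sigma>' \<and>
      fst (\<sigma>' 1) = contents (u @ concat (map (\<lambda>w. enc_nat m @ w) xs))"
    if "\<sigma> 1 = (contents u, int (length u))" "\<sigma> 3 = (contents (enc_nat m), 0)" for \<sigma> u xs
    using that
  proof (induction xs arbitrary: \<sigma> u)
    case Nil
    then show ?case by (auto intro!: exI[of _ \<sigma>] runs_skip[simplified])
  next
    case (Cons w xs)
    let ?e = "enc_nat m" and ?p = "foldr (\<lambda>w p. copy 3 1 \<then> rewind 3 \<then> emit 1 w \<then> p) xs skip"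
    define \<sigma>1 where "\<sigma>1 = \<sigma>(3 := (contents ?e, int (length ?e)), 1 := (contents (u @ ?e), int (length (u @ ?e))))"
    have 1: "runs (copy 3 1) \<sigma> (2 * length ?e + 1) \<sigma>1"
      unfolding \<sigma>1_def by (rule runs_copy) (use Cons.prems Blank_enc_nat in auto)
    define \<sigma>2 where "\<sigma>2 = \<sigma>1(3 := (contents ?e, 0))"
    have 2: "runs (rewind 3) \<sigma>1 (2 * length ?e + 3) \<sigma>2"
      unfolding \<sigma>2_def
      by (rule runs_rewind[of _ _ _ "length ?e"]) (use Blank_enc_nat in \<open>auto simp: \<sigma>1_def\<close>)
    define \<sigma>3 where "\<sigma>3 = \<sigma>2(1 := (contents ((u @ ?e) @ w), int (length ((u @ ?e) @ w))))"
    have 3: "runs (emit 1 w) \<sigma>2 (length w + 1) \<sigma>3"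
      unfolding \<sigma>3_def by (rule runs_emit) (simp add: \<sigma>2_def \<sigma>1_def)
    have \<sigma>3: "\<sigma>3 1 = (contents ((u @ ?e) @ w), int (length ((u @ ?e) @ w)))" "\<sigma>3 3 = (contents ?e, 0)"
      by (simp_all add: \<sigma>3_def \<sigma>2_def)
    obtain \<sigma>' where 4: "runs ?p \<sigma>3 (1 + (\<Sum>w\<leftarrow>xs. 4 * m + 5 + length w)) \<sigma>'"
      and \<sigma>': "fst (\<sigma>' 1) = contents (((u @ ?e) @ w) @ concat (map (\<lambda>w. enc_nat m @ w) xs))"
      using Cons.IH[of \<sigma>3 "(u @ ?e) @ w", OF \<sigma>3(1,2)] by blast
    have t: "2 * length ?e + 1 + (2 * length ?e + 3 + (length w + 1 + (1 + (\<Sum>w\<leftarrow>xs. 4 * m + 5 + length w))))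
      \<le> 1 + (\<Sum>w\<leftarrow>w # xs. 4 * m + 5 + length w)"
      using length_enc_nat[of m] by simp
    show ?case
      using runs_mono[OF runs_Seq[OF 1 runs_Seq[OF 2 runs_Seq[OF 3 4]]] t] \<sigma>'
      by (intro exI[of _ \<sigma>']) simp
  qed
  define \<sigma>1 where "\<sigma>1 = \<sigma>(1 := (contents (u @ w0), int (length (u @ w0))))"
  have 1: "runs (emit 1 w0) \<sigma> (length w0 + 1) \<sigma>1"
    unfolding \<sigma>1_def by (rule runs_emit) (rule assms)
  obtain \<sigma>' where 2: "runs (foldr (\<lambda>w p. copy 3 1 \<then> rewind 3 \<then> emit 1 w \<then> p) ws skip) \<sigma>1
      (1 + (\<Sum>w\<leftarrow>ws. 4 * m + 5 + length w)) \<sigma>'"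
    and \<sigma>': "fst (\<sigma>' 1) = contents ((u @ w0) @ concat (map (\<lambda>w. enc_nat m @ w) ws))"
    using *[of \<sigma>1 "u @ w0" ws] assms by (auto simp: \<sigma>1_def)
  show ?thesis
    using runs_mono[OF runs_Seq[OF 1 2], of "length w0 + 2 + (\<Sum>w\<leftarrow>ws. 4 * m + 5 + length w)"] \<sigma>' enc_rad[OF assms(3)]
    unfolding radius_prog_def by (intro exI[of _ \<sigma>']) simp
qed

text \<open>Targets arise clause by clause but are encoded after all rows, so they wait on tape 2
  until the rows are complete.\<close>

definition targets_prog :: prog where
  "targets_prog = rewind 2 \<then> copy 2 1 \<then> emit 1 [Hash]"

lemma runs_targets:
  assumes "Blank \<notin> set (targ S)"
  shows "\<exists>\<sigma>. runs targets_prog (conf S) (4 * length (targ S) + 6) \<sigma> \<and>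
    \<sigma> 1 = (contents (outp S @ targ S @ [Hash]), int (length (outp S @ targ S @ [Hash]))) \<and>
    \<sigma> 3 = (contents (enc_nat (count S)), 0)"
proof -
  let ?t = "targ S" and ?u = "outp S"
  define \<sigma>1 where "\<sigma>1 = (conf S)(2 := (contents ?t, 0))"
  have 1: "runs (rewind 2) (conf S) (2 * length ?t + 3) \<sigma>1"
    unfolding \<sigma>1_def by (rule runs_rewind[of _ _ _ "length ?t"]) (use assms in \<open>auto simp: conf_def\<close>)
  define \<sigma>2 where "\<sigma>2 = \<sigma>1(2 := (contents ?t, int (length ?t)), 1 := (contents (?u @ ?t), int (length (?u @ ?t))))"
  have 2: "runs (copy 2 1) \<sigma>1 (2 * length ?t + 1) \<sigma>2"
    unfolding \<sigma>2_def by (rule runs_copy) (use assms in \<open>auto simp: \<sigma>1_def conf_def\<close>)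
  define \<sigma>3 where "\<sigma>3 = \<sigma>2(1 := (contents ((?u @ ?t) @ [Hash]), int (length ((?u @ ?t) @ [Hash]))))"
  have 3: "runs (emit 1 [Hash]) \<sigma>2 (length [Hash] + 1) \<sigma>3"
    unfolding \<sigma>3_def by (rule runs_emit) (simp add: \<sigma>2_def \<sigma>1_def)
  have "\<sigma>3 1 = (contents (?u @ ?t @ [Hash]), int (length (?u @ ?t @ [Hash])))"
    "\<sigma>3 3 = (contents (enc_nat (count S)), 0)"
    by (simp_all add: \<sigma>3_def \<sigma>2_def \<sigma>1_def conf_def)
  moreover have "runs targets_prog (conf S) (4 * length ?t + 6) \<sigma>3"
    using runs_mono[OF runs_Seq[OF 1 runs_Seq[OF 2 3]], of "4 * length ?t + 6"]
    unfolding targets_prog_def by simp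
  ultimately show ?thesis by blast
qed

definition red_prog :: prog where
  "red_prog = prefix_prog \<then> clauses_prog \<then> unused_prog \<then> targets_prog \<then> radius_prog"

definition red :: "formula \<Rightarrow> cvp_desc" where
  "red \<Phi> = (fst \<Phi>, map (map num) (red_rows \<Phi>), map num (red_targets \<Phi>), rad (length (snd \<Phi>)))"

lemma enc_red:
  "enc_cvp (red \<Phi>) = replicate (fst \<Phi>) One @ [Hash] @ enc_rows (red_rows \<Phi>) @
    enc_words (red_targets \<Phi>) @ [Hash] @ enc_num (rad (length (snd \<Phi>)))"
  by (simp add: enc_cvp_def red_def enc_rows_def enc_words_def enc_row_def[abs_def] word_def[abs_def] o_def)

text \<open>Rewinding and copying take a blank for the end of the word.\<close>

lemma Blank_enc_words: "Blank \<notin> set (enc_words t)"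
  using Blank_enc_nat by (auto simp: enc_words_def word_def enc_num_def enc_int_def)

lemma negs_le: "negs c \<le> length c"
  by (simp add: negs_def)

lemma length_enc_targets:
  assumes "\<forall>c\<in>set cs. length c = k"
  shows "length (enc_words (red_targets (n, cs))) \<le> ((k + 1) * length cs + n) * W"
proof -
  have "\<bar>v\<bar> \<le> int k" if "v \<in> set (red_targets (n, cs))" for v
  proof -
    consider b where "v = of_bool b" | c where "c \<in> set cs" "v = 1 - int (negs c)"
      using \<open>v \<in> _\<close> by (auto simp: red_targets_def clause_targets_def split: if_splits)
        (metis of_bool_eq(1))
    then show ?thesis
    proof cases
      case 2
      with negs_le[of c] assms have "negs c \<le> k" by simp
      with 2 k show ?thesis by simp
    qed (use k in simp)
  qed
  then have "length (enc_words (red_targets (n, cs))) \<le> (\<Sum>v\<leftarrow>red_targets (n, cs). W)"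
    unfolding enc_words_def length_concat map_map
    by (intro sum_list_mono) (auto simp: word_def intro: length_num)
  also have "\<dots> = length (red_targets (n, cs)) * W"
    by (simp add: sum_list_triv)
  also have "length (red_targets (n, cs)) = (k + 1) * length cs + n"
    using assms unfolding red_targets_def
    by (induction cs) (auto simp: clause_targets_def)
  finally show ?thesis .
qed

lemma runs_red:
  assumes "(n, cs) \<in> ksat_formulas k"
  defines "w \<equiv> enc_formula (n, cs)" and "m \<equiv> length cs"
  shows "\<exists>\<sigma>. runs red_prog (conf (start w))
      (4 * n + 7 + (m * Suc ((4 * k + 5) * (Q * (n + 1)) + 4 * m) + 1 +
       (2 * length w + 5 + n * (2 * Q * (n + 1)) +
       (4 * (((k + 1) * m + n) * W) + 6 + (length w0 + 2 + (\<Sum>w\<leftarrow>ws. 4 * m + 5 + length w)))))) \<sigma> \<and>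
    fst (\<sigma> 1) = contents (enc_cvp (red (n, cs)))"
proof -
  let ?v = "concat (map enc_clause cs)"
  have w: "w = replicate n One @ Hash # ?v" by (simp add: w_def enc_formula_def)
  have cs: "\<forall>c\<in>set cs. length c = k \<and> (\<forall>l\<in>set c. fst l < n)" "m > 0"
    using assms(1) by (fastforce simp: ksat_formulas_def m_def)+
  have noBlank: "Blank \<notin> set w"
    by (auto simp: w enc_clause_eq enc_lit_def sign_sym_def)
  define S1 where "S1 = start w\<lparr>pos := int n + 1, outp := replicate n One @ [Hash], ncol := n\<rparr>"
  have 1: "runs prefix_prog (conf (start w)) (4 * n + 7) (conf S1)"
    unfolding S1_def by (rule runs_prefix[OF w])
  define S2 where "S2 = S1\<lparr>pos := pos S1 + int (length ?v),
      outp := outp S1 @ enc_rows (concat (map (clause_rows n) cs)),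
      targ := targ S1 @ enc_words (concat (map clause_targets cs)),
      count := m, used := occupied (vars cs)\<rparr>"
  have "input_is S1 ?v"
    using contents_append_right[of _ "replicate n One @ [Hash]" ?v]
    by (simp add: input_is_def S1_def w start_def add.assoc add.left_commute[of 1])
  then have 2: "runs clauses_prog (conf S1) (m * Suc ((4 * k + 5) * (Q * (n + 1)) + 4 * m) + 1) (conf S2)"
    using runs_clauses[of S1 cs] cs(1) by (simp add: S1_def S2_def start_def m_def)
  obtain S3 where 3: "runs unused_prog (conf S2) (2 * length w + 5 + n * (2 * Q * (n + 1))) (conf S3)"
    and S3: "outp S3 = outp S2 @ enc_rows (map (unused_row n (vars cs)) [0..<n])"
      "targ S3 = targ S2 @ enc_words (replicate n 0)" "count S3 = count S2"
    using runs_unused[of S2 "vars cs" w n ?v] w noBlank by (auto simp: S2_def S1_def start_def)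
  have targ: "targ S3 = enc_words (red_targets (n, cs))"
    by (simp add: S3 S2_def S1_def start_def red_targets_def)
  have outp: "outp S3 = replicate n One @ [Hash] @ enc_rows (red_rows (n, cs))"
    by (simp add: S3 S2_def S1_def start_def red_rows_def)
  have count: "count S3 = m" by (simp add: S3 S2_def)
  obtain \<sigma> where 4: "runs targets_prog (conf S3) (4 * length (targ S3) + 6) \<sigma>"
    and \<sigma>: "\<sigma> 1 = (contents (outp S3 @ targ S3 @ [Hash]), int (length (outp S3 @ targ S3 @ [Hash])))"
      "\<sigma> 3 = (contents (enc_nat (count S3)), 0)"
    using runs_targets[of S3] Blank_enc_words targ by metis
  have 4: "runs targets_prog (conf S3) (4 * (((k + 1) * m + n) * W) + 6) \<sigma>"
    by (rule runs_mono[OF 4]) (use length_enc_targets[of cs n] cs(1) in \<open>simp add: targ m_def\<close>)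
  obtain \<sigma>' where 5: "runs radius_prog \<sigma> (length w0 + 2 + (\<Sum>w\<leftarrow>ws. 4 * m + 5 + length w)) \<sigma>'"
    and \<sigma>': "fst (\<sigma>' 1) = contents ((outp S3 @ targ S3 @ [Hash]) @ enc_num (rad m))"
    using runs_radius[OF \<sigma>(1) \<sigma>(2)[unfolded count] cs(2)] by blast
  have "(outp S3 @ targ S3 @ [Hash]) @ enc_num (rad m) = enc_cvp (red (n, cs))"
    by (simp add: enc_red outp targ m_def)
  with \<sigma>' runs_Seq[OF 1 runs_Seq[OF 2 runs_Seq[OF 3 runs_Seq[OF 4 5]]]]
  show ?thesis unfolding red_prog_def by metis
qed

section \<open>Only the tapes below \<open>k + 7\<close> matter\<close>

lemma tapes_below_mv: "tapes_below K (mv A d)"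
  by (simp add: mv_def agree_def)

lemma tapes_below_emit: "tapes_below K (emit i w)"
  unfolding emit_def by (induction w) (simp_all add: put_def skip_def agree_def)

lemma tapes_below_rewind: "i < K \<Longrightarrow> tapes_below K (rewind i)"
  by (simp add: rewind_def tapes_below_mv agree_def)

lemma tapes_below_copy: "i < K \<Longrightarrow> tapes_below K (copy i j)"
  by (simp add: copy_def agree_def)

lemma tapes_below_incr: "i < K \<Longrightarrow> tapes_below K (incr i)"
  by (simp add: incr_def put_def tapes_below_rewind agree_def)

lemma tapes_below_switch:
  assumes "\<And>r r'. agree K r r' \<Longrightarrow> g r = g r'" "\<And>v. tapes_below K (P v)"
  shows "tapes_below K (switch g vs P)"
  unfolding switch_def
proof (induction vs)
  case (Cons v vs)
  then show ?case using assms by (auto dest: assms(1))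
qed (simp add: skip_def agree_def)

lemma in_columns_agree: "4 < K \<Longrightarrow> agree K r r' \<Longrightarrow> in_columns r = in_columns r'"
  by (simp add: in_columns_def agree_def)

lemma tapes_below_first_col: "4 < K \<Longrightarrow> tapes_below K first_col"
  by (auto simp: first_col_def tapes_below_mv in_columns_agree)

lemma tapes_below_row:
  assumes "4 < K" "\<And>r r'. agree K r r' \<Longrightarrow> g r = g r'"
  shows "tapes_below K (row_prog g V clr)"
proof -
  have "tapes_below K (switch g V (\<lambda>v. emit 1 (word v)))"
    by (rule tapes_below_switch) (auto simp: tapes_below_emit dest: assms(2))
  then show ?thesis
    using assms(1) in_columns_agree
    by (auto simp: row_prog_def tapes_below_emit tapes_below_first_col advance_def agree_def in_columns_def)
qed

lemma tapes_below_literal: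
  assumes "j < k"
  shows "tapes_below (k + 7) (literal_prog j b)"
proof -
  have "tapes_below (k + 7) (row_prog (\<lambda>r. of_bool (r (7 + j) \<noteq> Blank)) [0, 1] False)"
    by (rule tapes_below_row) (use assms in \<open>auto simp: agree_def\<close>)
  then show ?thesis
    by (simp add: literal_prog_def tapes_below_mv tapes_below_first_col tapes_below_emit)
      (simp add: agree_def)
qed

lemma tapes_below_literals: "m \<le> k \<Longrightarrow> tapes_below (k + 7) (literals_prog m v)"
  by (induction m arbitrary: v) (auto simp: tapes_below_emit tapes_below_literal agree_def)

lemma tapes_below_clauses: "tapes_below (k + 7) clauses_prog"
proof -
  have "tapes_below (k + 7)
      (row_prog (\<lambda>r. \<Sum>j<k. sign_val (r (7 + j))) (map (\<lambda>i. int i - int k) [0..<2 * k + 1]) True)"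
    by (rule tapes_below_row) (auto simp: agree_def intro!: sum.cong)
  then show ?thesis
    by (simp add: clauses_prog_def clause_prog_def tapes_below_mv tapes_below_incr tapes_below_literals)
      (simp add: agree_def)
qed

lemma tapes_below_unused: "tapes_below (k + 7) unused_prog"
proof -
  have "tapes_below (k + 7) (row_prog (\<lambda>r. of_bool (r 6 = One \<and> r 5 = Blank)) [0, 1] False)"
    by (rule tapes_below_row) (auto simp: agree_def)
  then show ?thesis
    by (simp add: unused_prog_def tapes_below_mv tapes_below_rewind tapes_below_emit)
      (simp add: agree_def)
qed

lemma tapes_below_radius: "tapes_below (k + 7) radius_prog"
proof -
  have "tapes_below (k + 7) (foldr (\<lambda>w p. copy 3 1 \<then> rewind 3 \<then> emit 1 w \<then> p) xs skip)" for xs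
    by (induction xs)
      (simp_all add: tapes_below_copy tapes_below_rewind tapes_below_emit, simp add: skip_def agree_def)
  then show ?thesis by (simp add: radius_prog_def tapes_below_emit)
qed

lemma tapes_below_red: "tapes_below (k + 7) red_prog"
proof -
  have "tapes_below (k + 7) prefix_prog"
    by (simp add: prefix_prog_def tapes_below_mv tapes_below_emit tapes_below_first_col)
      (simp add: agree_def)
  then show ?thesis
    by (simp add: red_prog_def tapes_below_clauses tapes_below_unused tapes_below_radius
        targets_prog_def tapes_below_rewind tapes_below_copy tapes_below_emit)
qed

text \<open>The number of variables and the number of clauses are both at most the input length
  \<open>L\<close>, and every phase costs at most a constant times a product of two such quantities.
  All bounds are therefore stated as multiples of \<open>X\<close>, the square of
  \<open>L + 1\<close>.\<close>

lemma poly_time_red: "poly_time_on (ksat_formulas k) enc_formula enc_cvp red"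
proof -
  define A where "A = (\<Sum>w\<leftarrow>ws. 9 + length w)"
  \<comment> \<open>\<open>2 * C\<close> dominates the sum of the coefficients of \<open>X\<close>
    in the bounds \<open>t1\<close> to \<open>t5\<close>; the estimate of \<open>X\<close> by
    \<open>2 * L ^ 2 + 2\<close> supplies the other factor 2.\<close>
  define C where "C = 24 + 10 * k * Q + 20 * Q + 4 * (k + 2) * W + length w0 + A"
  have "outputs_within (compile (k + 7) red_prog) (enc_formula \<Phi>)
      (4 * C * length (enc_formula \<Phi>) ^ 2 + 4 * C) (enc_cvp (red \<Phi>))"
    if \<Phi>: "\<Phi> \<in> ksat_formulas k" for \<Phi>
  proof -
    obtain n cs where [simp]: "\<Phi> = (n, cs)" by (cases \<Phi>)
    define w where "w = enc_formula \<Phi>"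
    define m L where "m = length cs" and "L = length w"
    \<comment> \<open>Every clause contributes at least its semicolon to the input.\<close>
    have "length cs \<le> length (concat (map enc_clause cs))"
      by (induction cs) (simp_all add: enc_clause_eq)
    then have "n \<le> L" "m \<le> L" by (simp_all add: L_def w_def m_def enc_formula_def)
    define X where "X = (L + 1) * (L + 1)"
    have XL: "L + 1 \<le> X" "1 \<le> X" by (simp_all add: X_def)
    have "m * (n + 1) \<le> X" "n * (n + 1) \<le> X" "m * m \<le> X"
      unfolding X_def by (rule mult_le_mono; use \<open>n \<le> L\<close> \<open>m \<le> L\<close> in simp)+
    moreover have "m \<le> X" "n \<le> X" "L \<le> X"
      using \<open>n \<le> L\<close> \<open>m \<le> L\<close> XL by linarith+
    ultimately have mn: "m * (n + 1) \<le> X" "n * (n + 1) \<le> X" "m * m \<le> X" "m \<le> X" "n \<le> X" "L \<le> X" .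
    have t1: "4 * n + 7 \<le> 11 * X" using mn XL by linarith
    have "m * Suc ((4 * k + 5) * (Q * (n + 1)) + 4 * m) + 1 =
        (4 * k + 5) * Q * (m * (n + 1)) + 4 * (m * m) + m + 1"
      by (simp add: algebra_simps)
    also have "\<dots> \<le> (4 * k + 5) * Q * X + 4 * X + X + X"
      using mn XL by (intro add_mono mult_le_mono) auto
    finally have t2: "m * Suc ((4 * k + 5) * (Q * (n + 1)) + 4 * m) + 1 \<le> ((4 * k + 5) * Q + 6) * X"
      by (simp add: algebra_simps)
    have "n * (2 * Q * (n + 1)) = 2 * Q * (n * (n + 1))" by (simp only: mult.left_commute)
    also have "\<dots> \<le> 2 * Q * X" using mn by (intro mult_le_mono) auto
    finally have t3: "2 * L + 5 + n * (2 * Q * (n + 1)) \<le> (2 * Q + 7) * X"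
      using mn XL by (simp add: algebra_simps)
    have "((k + 1) * m + n) * W \<le> ((k + 1) * X + X) * W"
      using mn by (intro mult_le_mono add_mono) auto
    then have t4: "4 * (((k + 1) * m + n) * W) + 6 \<le> (4 * (k + 2) * W + 6) * X"
      using XL by (simp add: algebra_simps)
    have "(\<Sum>w\<leftarrow>ws. 4 * m + 5 + length w) \<le> (\<Sum>w\<leftarrow>ws. (9 + length w) * X)"
    proof (intro sum_list_mono)
      fix v :: "sym list"
      have "length v * 1 \<le> length v * X" using XL by (intro mult_le_mono) auto
      then show "4 * m + 5 + length v \<le> (9 + length v) * X"
        using mn XL unfolding distrib_right mult_1_right by linarith
    qed
    then have "(\<Sum>w\<leftarrow>ws. 4 * m + 5 + length w) \<le> A * X"
      by (simp add: A_def sum_list_mult_const)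
    moreover have "length w0 * 1 \<le> length w0 * X" using XL by (intro mult_le_mono) auto
    ultimately have t5: "length w0 + 2 + (\<Sum>w\<leftarrow>ws. 4 * m + 5 + length w) \<le> (length w0 + 2 + A) * X"
      using XL unfolding distrib_right mult_1_right by linarith
    obtain \<sigma> where \<sigma>: "runs red_prog (conf (start w))
      (4 * n + 7 + (m * Suc ((4 * k + 5) * (Q * (n + 1)) + 4 * m) + 1 +
       (2 * length w + 5 + n * (2 * Q * (n + 1)) +
       (4 * (((k + 1) * m + n) * W) + 6 + (length w0 + 2 + (\<Sum>w\<leftarrow>ws. 4 * m + 5 + length w)))))) \<sigma>"
      "fst (\<sigma> 1) = contents (enc_cvp (red \<Phi>))"
      using runs_red[of n cs] \<Phi> unfolding w_def m_def by auto
    note \<sigma>(1)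
    moreover have "4 * n + 7 + (m * Suc ((4 * k + 5) * (Q * (n + 1)) + 4 * m) + 1 +
       (2 * length w + 5 + n * (2 * Q * (n + 1)) +
       (4 * (((k + 1) * m + n) * W) + 6 + (length w0 + 2 + (\<Sum>w\<leftarrow>ws. 4 * m + 5 + length w)))))
       \<le> 4 * C * L ^ 2 + 4 * C" (is "?T \<le> _")
    proof -
      have "?T \<le> 11 * X + (((4 * k + 5) * Q + 6) * X + ((2 * Q + 7) * X +
          ((4 * (k + 2) * W + 6) * X + (length w0 + 2 + A) * X)))"
        using t1 t2 t3 t4 t5 unfolding L_def by (intro add_mono)
      also have "\<dots> = (11 + ((4 * k + 5) * Q + 6) + (2 * Q + 7) + (4 * (k + 2) * W + 6) + (length w0 + 2 + A)) * X"
        by (simp only: distrib_right add.assoc)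
      also have "\<dots> \<le> (2 * C) * X"
        by (intro mult_le_mono1) (simp add: C_def algebra_simps)
      also have "\<dots> \<le> (2 * C) * (2 * L ^ 2 + 2)"
      proof (intro mult_le_mono2)
        \<comment> \<open>The square of \<open>L - 1\<close> is nonnegative.\<close>
        have "2 * L \<le> L * L + 1" by (cases L) auto
        then show "X \<le> 2 * L ^ 2 + 2" by (simp add: X_def power2_eq_square algebra_simps)
      qed
      finally show ?thesis by (simp add: algebra_simps)
    qed
    ultimately have "runs red_prog (conf (start w)) (4 * C * L ^ 2 + 4 * C) \<sigma>"
      by (rule runs_mono)
    then have "outputs_within (compile (k + 7) red_prog) w (4 * C * L ^ 2 + 4 * C) (enc_cvp (red \<Phi>))"
      by (rule compile_outputs_within[where \<sigma> = "conf (start w)" and \<sigma>' = \<sigma>])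
        (use \<sigma>(2) in \<open>simp_all add: tapes_below_red conf_start\<close>)
    then show ?thesis unfolding L_def w_def .
  qed
  moreover have "wf_tm (compile (k + 7) red_prog)" by (rule wf_compile) simp
  ultimately show ?thesis unfolding poly_time_on_def by blast
qed

end

section \<open>Distances\<close>

definition row_val :: "nat \<Rightarrow> (nat \<Rightarrow> int) \<Rightarrow> int list \<Rightarrow> int" where
  "row_val n z r = (\<Sum>j<n. r ! j * z j)"

definition cost :: "nat \<Rightarrow> (nat \<Rightarrow> int) \<Rightarrow> int list list \<Rightarrow> int list \<Rightarrow> int" where
  "cost n z R T = (\<Sum>(r, t)\<leftarrow>zip R T. \<bar>row_val n z r - t\<bar>)"

definition lit_val :: "(nat \<Rightarrow> int) \<Rightarrow> literal \<Rightarrow> int" where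
  "lit_val z l = (if snd l then z (fst l) else 1 - z (fst l))"

definition clause_cost :: "(nat \<Rightarrow> int) \<Rightarrow> clause \<Rightarrow> int" where
  "clause_cost z c = (\<Sum>l\<leftarrow>c. \<bar>lit_val z l - 1\<bar>) + \<bar>(\<Sum>l\<leftarrow>c. lit_val z l) - 1\<bar>"

lemma cost_append:
  "length R = length T \<Longrightarrow> cost n z (R @ R') (T @ T') = cost n z R T + cost n z R' T'"
  by (simp add: cost_def)

lemma row_val_unit:
  "i < n \<Longrightarrow> row_val n z (map (\<lambda>x. of_bool (x = i)) [0..<n]) = z i"
  by (simp add: row_val_def of_bool_def if_distrib[of "\<lambda>a. a * _"] cong: if_cong)

text \<open>A negated literal has the value \<open>1 - z i\<close>: its linear part enters the
  coefficients, and its constant is what \<open>negs\<close> counts.\<close>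

lemma row_val_clause_coeff:
  assumes "\<forall>l\<in>set c. fst l < n"
  shows "row_val n z (map (clause_coeff c) [0..<n]) = (\<Sum>l\<leftarrow>c. lit_val z l) - int (negs c)"
  using assms
proof (induction c)
  case (Cons l c)
  obtain i b where l: "l = (i, b)" by (cases l)
  have "clause_coeff (l # c) x = (if i = x then if b then 1 else - 1 else 0) + clause_coeff c x" for x
    by (simp add: clause_coeff_def l)
  then have "row_val n z (map (clause_coeff (l # c)) [0..<n]) =
      (\<Sum>x<n. (if i = x then if b then z x else - z x else 0) + clause_coeff c x * z x)"
    unfolding row_val_def by (intro sum.cong) (auto simp: algebra_simps)
  also have "\<dots> = (if b then z i else - z i) + row_val n z (map (clause_coeff c) [0..<n])"
    using Cons.prems by (simp add: sum.distrib row_val_def l)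
  finally show ?case
    using Cons by (simp add: lit_val_def negs_def l)
qed (simp add: row_val_def clause_coeff_def negs_def)

lemma length_clause_rows: "length (clause_rows n c) = length (clause_targets c)"
  by (simp add: clause_rows_def clause_targets_def)

lemma cost_clause:
  assumes "\<forall>l\<in>set c. fst l < n"
  shows "cost n z (clause_rows n c) (clause_targets c) = clause_cost z c"
proof -
  have "cost n z (map (\<lambda>l. map (\<lambda>x. of_bool (x = fst l)) [0..<n]) c) (map (\<lambda>l. of_bool (snd l)) c) =
      (\<Sum>l\<leftarrow>c. \<bar>lit_val z l - 1\<bar>)"
    using assms by (induction c) (auto simp: cost_def row_val_unit lit_val_def)
  moreover have "cost n z [map (clause_coeff c) [0..<n]] [1 - int (negs c)] = \<bar>(\<Sum>l\<leftarrow>c. lit_val z l) - 1\<bar>"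
    by (simp add: cost_def row_val_clause_coeff[OF assms])
  ultimately show ?thesis
    by (simp add: clause_rows_def clause_targets_def cost_append clause_cost_def)
qed

lemma cost_unused:
  "cost n z (map (unused_row n U) [0..<n]) (replicate n 0) = (\<Sum>i\<leftarrow>[0..<n]. if i \<in> U then 0 else \<bar>z i\<bar>)"
proof -
  have val: "row_val n z (unused_row n U i) = (if i \<in> U then 0 else z i)" if "i < n" for i
    using row_val_unit[OF that, of z] by (simp add: unused_row_def row_val_def)
  have eq: "zip (map (unused_row n U) [0..<n]) (replicate n 0) = map (\<lambda>i. (unused_row n U i, 0)) [0..<n]"
    by (intro nth_equalityI) auto
  have "cost n z (map (unused_row n U) [0..<n]) (replicate n 0) =
      (\<Sum>i\<leftarrow>[0..<n]. \<bar>row_val n z (unused_row n U i)\<bar>)"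
    unfolding cost_def eq by (simp add: o_def)
  also have "\<dots> = (\<Sum>i\<leftarrow>[0..<n]. if i \<in> U then 0 else \<bar>z i\<bar>)"
    using val by (intro arg_cong[where f = sum_list]) simp
  finally show ?thesis .
qed

lemma cost_red:
  assumes "\<forall>c\<in>set cs. \<forall>l\<in>set c. fst l < n"
  shows "cost n z (red_rows (n, cs)) (red_targets (n, cs)) =
    (\<Sum>c\<leftarrow>cs. clause_cost z c) + (\<Sum>i\<leftarrow>[0..<n]. if i \<in> vars cs then 0 else \<bar>z i\<bar>)"
proof -
  have len: "length (concat (map (clause_rows n) cs)) = length (concat (map clause_targets cs))"
    by (simp add: length_concat o_def length_clause_rows)
  have "cost n z (concat (map (clause_rows n) cs)) (concat (map clause_targets cs)) =
    (\<Sum>c\<leftarrow>cs. clause_cost z c)"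
    using assms
    by (induction cs) (simp_all add: cost_append length_clause_rows cost_clause, simp add: cost_def)
  then show ?thesis
    by (simp add: red_rows_def red_targets_def cost_append len cost_unused)
qed

lemma clause_cost_ge: "clause_cost z c \<ge> int (length c) - 1"
proof -
  \<comment> \<open>With \<open>S\<close> the sum of the literal values, the last term of the cost
    is at least \<open>S - 1\<close>; this estimate of \<open>S - k\<close> then cancels the other
    terms and leaves \<open>k - 1\<close>.\<close>
  have "(\<Sum>l\<leftarrow>c. lit_val z l) - int (length c) \<ge> - (\<Sum>l\<leftarrow>c. \<bar>lit_val z l - 1\<bar>)"
    by (induction c) auto
  then show ?thesis by (simp add: clause_cost_def)
qed

lemma clause_cost_ge_unsat:
  assumes "\<not> sat_clause (\<lambda>i. z i \<ge> 1) c"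
  shows "clause_cost z c \<ge> int (length c) + 1"
proof -
  \<comment> \<open>Integrality enters here: if \<open>z i \<ge> 1\<close> fails, then
    \<open>z i \<le> 0\<close>.\<close>
  have "\<forall>l\<in>set c. lit_val z l \<le> 0"
    using assms by (force simp: sat_clause_def lit_val_def)
  then have "(\<Sum>l\<leftarrow>c. lit_val z l) \<le> 0 \<and> (\<Sum>l\<leftarrow>c. \<bar>lit_val z l - 1\<bar>) \<ge> int (length c)"
    by (induction c) auto
  then show ?thesis by (simp add: clause_cost_def)
qed

text \<open>For literal values 0 and 1 with sum \<open>S\<close>, the cost is
  \<open>k - S + \<bar>S - 1\<bar>\<close>: this is \<open>k - 1\<close> for
  \<open>S \<ge> 1\<close> and \<open>k + 1\<close> for \<open>S = 0\<close>. Agreement with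
  \<open>a\<close> is required only on the clause, because the vector used later vanishes at the
  variables without occurrences.\<close>

lemma clause_cost_assignment:
  assumes "\<And>l. l \<in> set c \<Longrightarrow> z (fst l) = of_bool (a (fst l))"
  shows "clause_cost z c = int (length c) + 1 - 2 * of_bool (sat_clause a c)"
proof -
  have val: "lit_val z l = of_bool (a (fst l) = snd l)" if "l \<in> set c" for l
    using assms[OF that] by (auto simp: lit_val_def)
  then have *: "(\<Sum>l\<leftarrow>c. \<bar>lit_val z l - 1\<bar>) = int (length c) - (\<Sum>l\<leftarrow>c. lit_val z l)"
    by (induction c) auto
  show ?thesis
  proof (cases "sat_clause a c")
    case True
    then obtain l where "l \<in> set c" "a (fst l) = snd l" by (force simp: sat_clause_def)
    then have "(\<Sum>l\<leftarrow>c. lit_val z l) \<ge> 1" using val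
    proof (induction c)
      case (Cons x c)
      have nonneg: "0 \<le> (\<Sum>l\<leftarrow>c. lit_val z l)"
        using Cons.prems(3) by (intro sum_list_nonneg) auto
      show ?case
      proof (cases "l = x")
        case True
        with Cons.prems nonneg show ?thesis by simp
      next
        case False
        with Cons have "1 \<le> (\<Sum>l\<leftarrow>c. lit_val z l)" by simp
        moreover have "0 \<le> lit_val z x" using Cons.prems(3)[of x] by simp
        ultimately show ?thesis by simp
      qed
    qed simp
    with True show ?thesis by (simp add: clause_cost_def *)
  next
    case False
    then have "\<forall>l\<in>set c. lit_val z l = 0" using val by (force simp: sat_clause_def)
    then have "(\<Sum>l\<leftarrow>c. lit_val z l) = 0" by (induction c) auto
    with False show ?thesis by (simp add: clause_cost_def *)
  qed
qed

section \<open>Cost of the instance against the value of the formula\<close>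

definition num_sat :: "(nat \<Rightarrow> bool) \<Rightarrow> clause list \<Rightarrow> nat" where
  "num_sat a cs = length (filter (sat_clause a) cs)"

text \<open>Rounding \<open>z\<close> to the assignment \<open>z i \<ge> 1\<close> bounds each
  clause from below, and the rows for variables without occurrences add nothing negative.\<close>

lemma cost_red_ge:
  assumes "(n, cs) \<in> ksat_formulas k"
  shows "cost n z (red_rows (n, cs)) (red_targets (n, cs)) \<ge>
    int (length cs) * (int k + 1) - 2 * int (num_sat (\<lambda>i. z i \<ge> 1) cs)"
proof -
  have cs: "\<forall>c\<in>set cs. length c = k" "\<forall>c\<in>set cs. \<forall>l\<in>set c. fst l < n"
    using assms by (fastforce simp: ksat_formulas_def)+
  have "(\<Sum>c\<leftarrow>cs. clause_cost z c) \<ge>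
      int (length cs) * (int k + 1) - 2 * int (num_sat (\<lambda>i. z i \<ge> 1) cs)"
    using cs(1)
  proof (induction cs)
    case (Cons c cs)
    have "clause_cost z c \<ge> int k + 1 - 2 * of_bool (sat_clause (\<lambda>i. z i \<ge> 1) c)"
      using clause_cost_ge[of c z] clause_cost_ge_unsat[of z c] Cons.prems by auto
    with Cons show ?case by (auto simp: num_sat_def algebra_simps)
  qed (simp add: num_sat_def)
  moreover have "0 \<le> (\<Sum>i\<leftarrow>[0..<n]. if i \<in> vars cs then 0 else \<bar>z i\<bar>)"
    by (intro sum_list_nonneg) auto
  ultimately show ?thesis using cost_red[OF cs(2)] by simp
qed

text \<open>Setting the variables without occurrences to 0 makes their unit rows free of cost and
  does not affect any clause.\<close>

lemma cost_red_assignment: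
  assumes "(n, cs) \<in> ksat_formulas k"
  shows "cost n (\<lambda>i. of_bool (a i \<and> i \<in> vars cs)) (red_rows (n, cs)) (red_targets (n, cs)) =
    int (length cs) * (int k + 1) - 2 * int (num_sat a cs)"
proof -
  let ?z = "\<lambda>i. of_bool (a i \<and> i \<in> vars cs) :: int"
  have cs: "\<forall>c\<in>set cs. length c = k" "\<forall>c\<in>set cs. \<forall>l\<in>set c. fst l < n"
    using assms by (fastforce simp: ksat_formulas_def)+
  have "clause_cost ?z c = int k + 1 - 2 * of_bool (sat_clause a c)" if "c \<in> set cs" for c
  proof -
    have "fst l \<in> vars cs" if "l \<in> set c" for l
      using that \<open>c \<in> set cs\<close> by (auto simp: vars_def)
    then show ?thesis using clause_cost_assignment[of c ?z a] that cs(1) by simp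
  qed
  then have "(\<Sum>c\<leftarrow>cs. clause_cost ?z c) = (\<Sum>c\<leftarrow>cs. int k + 1 - 2 * of_bool (sat_clause a c))"
    by (intro arg_cong[where f = sum_list]) simp
  also have "\<dots> = int (length cs) * (int k + 1) - 2 * int (num_sat a cs)"
    by (induction cs) (auto simp: num_sat_def algebra_simps)
  finally have "(\<Sum>c\<leftarrow>cs. clause_cost ?z c) = int (length cs) * (int k + 1) - 2 * int (num_sat a cs)" .
  moreover have "(\<Sum>i\<leftarrow>[0..<n]. if i \<in> vars cs then 0 else \<bar>?z i\<bar>) = 0"
    by (simp add: sum_list_0 cong: if_cong)
  ultimately show ?thesis using cost_red[OF cs(2)] by simp
qed

lemma val_bounds:
  assumes "(n, cs) \<in> ksat_formulas k"
  shows "real (num_sat a cs) \<le> val (n, cs) * real (length cs)"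
    and "\<exists>a. real (num_sat a cs) = val (n, cs) * real (length cs)"
proof -
  have cs: "length cs > 0" using assms by (auto simp: ksat_formulas_def)
  let ?f = "\<lambda>a. real (num_sat a cs) / real (length cs)"
  have val: "val (n, cs) = Max (range ?f)" by (simp add: val_def num_sat_def)
  \<comment> \<open>There are infinitely many assignments, but only finitely many fractions with
    denominator \<open>length cs\<close>; so the maximum exists and is attained.\<close>
  have "range ?f \<subseteq> (\<lambda>i. real i / real (length cs)) ` {..length cs}"
    by (auto simp: num_sat_def)
  then have fin: "finite (range ?f)" by (rule finite_subset) simp
  then have "?f a \<le> val (n, cs)" unfolding val by (intro Max_ge) auto
  with cs show "real (num_sat a cs) \<le> val (n, cs) * real (length cs)" by (simp add: field_simps)
  have "val (n, cs) \<in> range ?f" unfolding val using fin by (intro Max_in) auto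
  with cs show "\<exists>a. real (num_sat a cs) = val (n, cs) * real (length cs)"
    by (auto simp: field_simps)
qed

section \<open>Linear independence of the columns\<close>

lemma mult_mat_vec_unit:
  fixes B :: "'a :: semiring_1 mat"
  shows "i < dim_col B \<Longrightarrow> B *\<^sub>v unit_vec (dim_col B) i = col B i"
  by (intro eq_vecI) auto

lemma lin_indpt_colsI:
  assumes "\<And>v. v \<in> carrier_vec (dim_col B) \<Longrightarrow> B *\<^sub>v v = 0\<^sub>v (dim_row B) \<Longrightarrow> v = 0\<^sub>v (dim_col B)"
  shows "lin_indpt_cols B"
proof -
  interpret vec_space "TYPE(real)" "dim_row B" .
  have B: "B \<in> carrier_mat (dim_row B) (dim_col B)" by simp
  have dist: "distinct (cols B)"
    unfolding distinct_conv_nth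
  proof (intro allI impI notI)
    fix i j assume ij: "i < length (cols B)" "j < length (cols B)" "i \<noteq> j" "cols B ! i = cols B ! j"
    \<comment> \<open>Distinctness needs its own argument, since independence of the set of columns
      does not see repetitions. Equal columns would put the difference of two unit vectors into the
      kernel.\<close>
    let ?u = "unit_vec (dim_col B) i - unit_vec (dim_col B) j :: real vec"
    have "B *\<^sub>v ?u = B *\<^sub>v unit_vec (dim_col B) i - B *\<^sub>v unit_vec (dim_col B) j"
      by (rule mult_minus_distrib_mat_vec[OF B]) auto
    also have "\<dots> = 0\<^sub>v (dim_row B)"
      using ij by (intro eq_vecI) (auto simp: mult_mat_vec_unit)
    finally have "?u = 0\<^sub>v (dim_col B)" by (intro assms) auto
    then have "?u $ i = 0" using ij by simp
    with ij show False by simp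
  qed
  have "\<not> lin_dep (set (cols B))"
  proof
    assume "lin_dep (set (cols B))"
    from lin_depE[OF B this dist] obtain v where
      "v \<in> carrier_vec (dim_col B)" "v \<noteq> 0\<^sub>v (dim_col B)" "B *\<^sub>v v = 0\<^sub>v (dim_row B)" .
    with assms show False by blast
  qed
  with dist show ?thesis by (simp add: lin_indpt_cols_def)
qed

text \<open>Makes the kernel trivial: every coordinate can be read off from some row, a literal row
  if the variable occurs and its own extra row otherwise.\<close>

lemma unit_row_red:
  assumes "i < n" "\<forall>c\<in>set cs. \<forall>l\<in>set c. fst l < n"
  shows "map (\<lambda>x. of_bool (x = i)) [0..<n] \<in> set (red_rows (n, cs))"
proof (cases "i \<in> vars cs")
  case True
  then show ?thesis by (force simp: vars_def red_rows_def clause_rows_def)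
next
  case False
  then have "unused_row n (vars cs) i = map (\<lambda>x. of_bool (x = i)) [0..<n]"
    by (simp add: unused_row_def)
  with assms(1) show ?thesis by (force simp: red_rows_def)
qed

section \<open>The lattice instance and its distance\<close>

lemma length_red_rows_targets: "length (red_rows (n, cs)) = length (red_targets (n, cs))"
  by (simp add: red_rows_def red_targets_def length_concat o_def length_clause_rows)

lemma length_red_row: "r \<in> set (red_rows (n, cs)) \<Longrightarrow> length r = n"
  by (auto simp: red_rows_def clause_rows_def unused_row_def)

lemma length_nth_red_rows:
  "i < length (red_targets (n, cs)) \<Longrightarrow> length (red_rows (n, cs) ! i) = n"
  by (metis length_red_row length_red_rows_targets nth_mem)

text \<open>A positive factor common to basis, target and radius does not change the problem. It is
  left open here, so that each number format can pick the one for which the radius is easy to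
  write.\<close>

locale gap_reduction = number_encoding +
  fixes gs :: "real list" and \<alpha> \<epsilon> :: real
  assumes k2: "2 \<le> k" and \<alpha>: "0 < \<alpha>" and \<epsilon>: "\<epsilon> \<le> 1"
    and wf_num: "wf_num gs (num v)" and wf_rad: "wf_num gs (rad m)"
    and num_val: "num_val gs (num v) = \<alpha> * of_int v"
    and num_val_rad: "num_val gs (rad m) = \<alpha> * (real m * (real k + 1 - 2 * \<epsilon>))"
begin

lemma cvp_of_red:
  "cvp_of gs (red (n, cs)) =
    (mat (length (red_rows (n, cs))) n (\<lambda>(i, j). \<alpha> * of_int (red_rows (n, cs) ! i ! j)),
     vec (length (red_rows (n, cs))) (\<lambda>i. \<alpha> * of_int (red_targets (n, cs) ! i)),
     \<alpha> * (real (length cs) * (real k + 1 - 2 * \<epsilon>)))"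
  by (auto simp: cvp_of_def red_def num_val num_val_rad length_red_rows_targets length_nth_red_rows
      intro!: eq_matI eq_vecI)

lemma wf_red: "wf_cvp_desc gs (red (n, cs))"
  by (auto simp: wf_cvp_desc_def red_def wf_num wf_rad length_red_rows_targets length_red_row)

lemma red_instance:
  assumes "(n, cs) \<in> ksat_formulas k"
  shows "cvp_of gs (red (n, cs)) \<in> cvp_instances n"
proof -
  let ?R = "red_rows (n, cs)"
  let ?B = "mat (length ?R) n (\<lambda>(i, j). \<alpha> * of_int (?R ! i ! j)) :: real mat"
  have cs: "\<forall>c\<in>set cs. \<forall>l\<in>set c. fst l < n" "cs \<noteq> []"
    using assms by (fastforce simp: ksat_formulas_def)+
  have "lin_indpt_cols ?B"
  proof (rule lin_indpt_colsI)
    fix v :: "real vec" assume v: "v \<in> carrier_vec (dim_col ?B)" "?B *\<^sub>v v = 0\<^sub>v (dim_row ?B)"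
    show "v = 0\<^sub>v (dim_col ?B)"
    proof (rule eq_vecI)
      fix i assume "i < dim_vec (0\<^sub>v (dim_col ?B))"
      then have i: "i < n" by simp
      from unit_row_red[OF i cs(1)] obtain p where
        p: "p < length ?R" "?R ! p = map (\<lambda>x. of_bool (x = i)) [0..<n]"
        by (metis in_set_conv_nth)
      have "0 = (?B *\<^sub>v v) $ p" using v p by simp
      also have "\<dots> = (\<Sum>j<n. \<alpha> * of_int (?R ! p ! j) * v $ j)"
        using v(1) p(1) by (simp add: scalar_prod_def atLeast0LessThan)
      also have "\<dots> = (\<Sum>j<n. if j = i then \<alpha> * v $ i else 0)"
        using p by (intro sum.cong) auto
      also have "\<dots> = \<alpha> * v $ i" using i by simp
      finally show "v $ i = 0\<^sub>v (dim_col ?B) $ i" using \<alpha> i by simp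
    qed (use v in simp)
  qed
  \<comment> \<open>From \<open>\<epsilon> \<le> 1\<close> and \<open>k \<ge> 2\<close> the second
    factor is at least \<open>k - 1 > 0\<close>.\<close>
  moreover have "0 < real (length cs) * (real k + 1 - 2 * \<epsilon>)"
    using cs(2) k2 \<epsilon> by (intro mult_pos_pos) auto
  ultimately show ?thesis
    using \<alpha> by (simp add: cvp_of_red cvp_instances_def)
qed

lemma l1_norm_red:
  fixes z :: "int vec"
  assumes "cvp_of gs (red (n, cs)) = (B, t, r)" "z \<in> carrier_vec n"
  shows "l1_norm (B *\<^sub>v map_vec of_int z - t) =
    \<alpha> * of_int (cost n (\<lambda>i. z $ i) (red_rows (n, cs)) (red_targets (n, cs)))"
proof -
  let ?R = "red_rows (n, cs)" and ?T = "red_targets (n, cs)"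
  have B: "B = mat (length ?R) n (\<lambda>(i, j). \<alpha> * of_int (?R ! i ! j))"
    and t: "t = vec (length ?R) (\<lambda>i. \<alpha> * of_int (?T ! i))"
    using assms(1) by (simp_all add: cvp_of_red)
  have entry: "(B *\<^sub>v map_vec of_int z - t) $ i = \<alpha> * of_int (row_val n (\<lambda>i. z $ i) (?R ! i) - ?T ! i)"
    if "i < length ?R" for i
    using that assms(2)
    by (simp add: B t scalar_prod_def atLeast0LessThan row_val_def sum_distrib_left algebra_simps)
  have "l1_norm (B *\<^sub>v map_vec of_int z - t) =
      (\<Sum>i<length ?R. \<bar>\<alpha> * of_int (row_val n (\<lambda>i. z $ i) (?R ! i) - ?T ! i)\<bar>)"
    unfolding l1_norm_def by (intro sum.cong) (use entry in \<open>auto simp: t\<close>)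
  also have "\<dots> = \<alpha> * of_int (\<Sum>i<length ?R. \<bar>row_val n (\<lambda>i. z $ i) (?R ! i) - ?T ! i\<bar>)"
    using \<alpha> by (simp add: abs_mult sum_distrib_left)
  also have "(\<Sum>i<length ?R. \<bar>row_val n (\<lambda>i. z $ i) (?R ! i) - ?T ! i\<bar>) = cost n (\<lambda>i. z $ i) ?R ?T"
    unfolding cost_def using length_red_rows_targets[of n cs]
    by (simp add: sum_list_sum_nth atLeast0LessThan)
  finally show ?thesis .
qed

lemma red_yes:
  assumes "\<Phi> \<in> gap_ksat_yes k \<epsilon>"
  shows "cvp_of gs (red \<Phi>) \<in> cvp1_yes"
proof -
  obtain n cs where \<Phi>: "\<Phi> = (n, cs)" by (cases \<Phi>)
  have cs: "(n, cs) \<in> ksat_formulas k" "\<epsilon> \<le> val (n, cs)"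
    using assms by (auto simp: gap_ksat_yes_def \<Phi>)
  obtain B t r where D: "cvp_of gs (red (n, cs)) = (B, t, r)" by (metis prod_cases3)
  have inst: "(B, t, r) \<in> cvp_instances n" using red_instance[OF cs(1)] by (simp add: D)
  have r: "r = \<alpha> * (real (length cs) * (real k + 1 - 2 * \<epsilon>))" using D by (simp add: cvp_of_red)
  obtain a where a: "real (num_sat a cs) = val (n, cs) * real (length cs)"
    using val_bounds(2)[OF cs(1)] by blast
  \<comment> \<open>An optimal assignment, cut down to the variables that occur.\<close>
  define z where "z = vec n (\<lambda>i. of_bool (a i \<and> i \<in> vars cs) :: int)"
  have "cost n (\<lambda>i. z $ i) (red_rows (n, cs)) (red_targets (n, cs)) =
      cost n (\<lambda>i. of_bool (a i \<and> i \<in> vars cs)) (red_rows (n, cs)) (red_targets (n, cs))"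
    by (simp add: cost_def row_val_def z_def)
  then have "l1_norm (B *\<^sub>v map_vec of_int z - t) =
      \<alpha> * (real (length cs) * (real k + 1) - 2 * real (num_sat a cs))"
    using l1_norm_red[OF D, of z] cost_red_assignment[OF cs(1), of a] by (simp add: z_def)
  also have "\<dots> \<le> r"
  proof -
    have "\<epsilon> * real (length cs) \<le> real (num_sat a cs)"
      unfolding a using cs(2) by (intro mult_right_mono) auto
    then show ?thesis using \<alpha> by (simp add: r algebra_simps)
  qed
  finally have le: "l1_norm (B *\<^sub>v map_vec of_int z - t) \<le> r" .
  have "B *\<^sub>v map_vec of_int z \<in> lattice B"
    using inst by (auto simp: lattice_def cvp_instances_def z_def)
  moreover have "bdd_below ((\<lambda>x. l1_norm (x - t)) ` lattice B)"
    by (rule bdd_belowI[of _ 0]) (auto simp: l1_norm_def intro!: sum_nonneg)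
  ultimately have "dist1 (lattice B) t \<le> l1_norm (B *\<^sub>v map_vec of_int z - t)"
    unfolding dist1_def by (intro cINF_lower)
  with le inst show ?thesis by (auto simp: cvp1_yes_def \<Phi> D)
qed

lemma red_no:
  assumes "\<Phi> \<in> gap_ksat_no k \<delta>" and "\<gamma> * (real k + 1 - 2 * \<epsilon>) = real k + 1 - 2 * \<delta>"
  shows "cvp_of gs (red \<Phi>) \<in> cvp1_no \<gamma>"
proof -
  obtain n cs where \<Phi>: "\<Phi> = (n, cs)" by (cases \<Phi>)
  have cs: "(n, cs) \<in> ksat_formulas k" "val (n, cs) < \<delta>" "0 < real (length cs)"
    using assms by (auto simp: gap_ksat_no_def \<Phi> ksat_formulas_def)
  obtain B t r where D: "cvp_of gs (red (n, cs)) = (B, t, r)" by (metis prod_cases3)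
  have inst: "(B, t, r) \<in> cvp_instances n" using red_instance[OF cs(1)] by (simp add: D)
  have "\<gamma> * r = \<alpha> * (real (length cs) * (\<gamma> * (real k + 1 - 2 * \<epsilon>)))"
    using D by (simp add: cvp_of_red)
  then have "\<gamma> * r = \<alpha> * (real (length cs) * (real k + 1 - 2 * \<delta>))"
    unfolding assms(2) .
  \<comment> \<open>A bound that holds at every lattice point passes to the infimum only as a weak
    inequality. Strictness is therefore gained beforehand, from
    \<open>val (n, cs) < \<delta>\<close>.\<close>
  also have "\<dots> < \<alpha> * (real (length cs) * (real k + 1 - 2 * val (n, cs)))"
    using \<alpha> cs by (intro mult_strict_left_mono) auto
  also have "\<dots> \<le> dist1 (lattice B) t"
    unfolding dist1_def
  proof (rule cINF_greatest)
    show "lattice B \<noteq> {}" unfolding lattice_def using zero_carrier_vec by blast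
  next
    fix x assume "x \<in> lattice B"
    then obtain z :: "int vec" where z: "z \<in> carrier_vec n" "x = B *\<^sub>v map_vec of_int z"
      using inst by (auto simp: lattice_def cvp_instances_def)
    let ?a = "\<lambda>i. z $ i \<ge> 1"
    have "int (length cs) * (int k + 1) - 2 * int (num_sat ?a cs) \<le>
        cost n (\<lambda>i. z $ i) (red_rows (n, cs)) (red_targets (n, cs))" (is "?l \<le> ?c")
      by (rule cost_red_ge[OF cs(1)])
    then have "real_of_int ?l \<le> of_int ?c" by (rule of_int_le_iff[THEN iffD2])
    moreover have "real (length cs) * (real k + 1 - 2 * val (n, cs)) \<le> real_of_int ?l"
      using val_bounds(1)[OF cs(1), of ?a] by (simp add: algebra_simps)
    ultimately show "\<alpha> * (real (length cs) * (real k + 1 - 2 * val (n, cs))) \<le> l1_norm (x - t)"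
      using \<alpha> unfolding z(2) l1_norm_red[OF D z(1)] by (intro mult_left_mono) auto
  qed
  finally show ?thesis using inst by (auto simp: cvp1_no_def \<Phi> D)
qed

lemma reduction:
  assumes "\<gamma> * (real k + 1 - 2 * \<epsilon>) = real k + 1 - 2 * \<delta>"
  shows "\<exists>f. poly_time_on (ksat_formulas k) enc_formula enc_cvp f \<and>
       (\<forall>\<Phi> \<in> ksat_formulas k.
          wf_cvp_desc gs (f \<Phi>) \<and> cvp_of gs (f \<Phi>) \<in> cvp_instances (num_vars \<Phi>)) \<and>
       (\<forall>\<Phi> \<in> gap_ksat_yes k \<epsilon>. cvp_of gs (f \<Phi>) \<in> cvp1_yes) \<and>
       (\<forall>\<Phi> \<in> gap_ksat_no k \<delta>. cvp_of gs (f \<Phi>) \<in> cvp1_no \<gamma>)"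
  using poly_time_red wf_red red_instance red_yes red_no[OF _ assms]
  by (intro exI[of _ red]) (auto simp: num_vars_def)

end

section \<open>The two number formats\<close>

lemma word_length_bound:
  fixes num :: "int \<Rightarrow> num_desc"
  shows "\<bar>v\<bar> \<le> int k \<Longrightarrow> length (enc_num (num v)) \<le> (\<Sum>v\<in>{- int k..int k}. length (enc_num (num v)))"
  by (rule member_le_sum) auto

lemma enc_nat_1: "enc_nat 1 = [One]"
  using enc_nat_double_Suc[of 0] by simp

text \<open>For rational \<open>\<epsilon>\<close>, scaling by the inverse of \<open>k + 1 - 2 * \<epsilon> = a / q\<close> makes the radius the
  number of clauses.\<close>

lemma gap_reduction_rational:
  assumes "2 \<le> k" "\<epsilon> \<le> 1" "\<epsilon> \<in> \<rat>"
  obtains num rad w0 ws W \<alpha> where "gap_reduction k num rad w0 ws W [1] \<alpha> \<epsilon>"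
proof -
  define x where "x = real k + 1 - 2 * \<epsilon>"
  have "x > 0" using assms(1,2) by (simp add: x_def)
  have "x \<in> \<rat>" unfolding x_def using assms(3) by (intro Rats_diff Rats_add Rats_mult) auto
  then obtain a q where aq: "q \<noteq> 0" "\<bar>x\<bar> = real a / real q"
    by (rule Rats_abs_nat_div_natE)
  with \<open>x > 0\<close> have x: "x = real a / real q" "a \<noteq> 0" by (auto intro!: gr0I)
  \<comment> \<open>With \<open>\<alpha> = q / a = 1 / x\<close> an entry \<open>v\<close> becomes
    \<open>v * q / a\<close>, and the radius \<open>m * x\<close> becomes \<open>m\<close>, written
    with denominator 1.\<close>
  let ?num = "\<lambda>v. [(v * int q, a)]" and ?rad = "\<lambda>m. [(int m, 1)]"
  have "gap_reduction k ?num ?rad [Zero] [[Slash, One, Comma, Semicolon]]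
      (\<Sum>v\<in>{- int k..int k}. length (enc_num (?num v))) [1] (real q / real a) \<epsilon>"
  proof (unfold_locales, goal_cases)
    case 2
    then show ?case by (rule word_length_bound)
  next
    case (10 m)
    show ?case using x aq(1) by (simp add: num_val_def flip: x_def)
  qed (use assms x aq in \<open>auto simp: enc_num_def enc_int_def enc_nat_1[simplified] wf_num_def num_val_def\<close>)
  then show ?thesis by (rule that)
qed

text \<open>Unscaled, the coefficient of 1 in the radius would be \<open>m * (k + 1)\<close>. The
  factor \<open>1 / (k + 1)\<close> turns it into \<open>m\<close>, and that of
  \<open>\<epsilon>\<close> into \<open>-2 * m / (k + 1)\<close> with a fixed denominator. So the
  machine has only to copy and to double \<open>m\<close>.\<close>

lemma gap_reduction_general:
  assumes "2 \<le> k" "\<epsilon> \<le> 1"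
  obtains num rad w0 ws W \<alpha> where "gap_reduction k num rad w0 ws W [1, \<delta>, \<epsilon>] \<alpha> \<epsilon>"
proof -
  let ?num = "\<lambda>v. [(v, k + 1), (0, 1), (0, 1)]"
    and ?rad = "\<lambda>m. [(int m, 1), (0, 1), (- int (2 * m), k + 1)]"
  have "gap_reduction k ?num ?rad [Zero]
      [[Slash, One, Comma, Zero, Slash, One, Comma, One, Zero],
       [Slash] @ enc_nat (k + 1) @ [Comma, Semicolon]]
      (\<Sum>v\<in>{- int k..int k}. length (enc_num (?num v))) [1, \<delta>, \<epsilon>] (1 / (real k + 1)) \<epsilon>"
  proof (unfold_locales, goal_cases)
    case 2
    then show ?case by (rule word_length_bound)
  next
    case (3 m)
    then have "nat (2 * int m) = 2 * m" by simp
    \<comment> \<open>In binary, doubling a positive number puts a \<open>Zero\<close> in front of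
      its code. The first word of the list ends with the minus sign, written \<open>One\<close>, and
      this \<open>Zero\<close>, so the copy of \<open>m\<close> that follows completes the numerator
      \<open>-2 * m\<close>.\<close>
    with 3 show ?case
      using enc_nat_double[of m] by (simp add: enc_num_def enc_int_def enc_nat_1[simplified])
  next
    case (10 m)
    show ?case
      by (simp add: num_val_def field_simps lessThan_Suc numeral_3_eq_3)
  qed (use assms in \<open>auto simp: wf_num_def num_val_def lessThan_Suc\<close>)
  then show ?thesis by (rule that)
qed

theorem theorem5p3:
  fixes k :: nat and \<delta> \<epsilon> \<gamma> :: real
  assumes "2 \<le> k"
    and "0 \<le> \<delta>" and "\<delta> < \<epsilon>" and "\<epsilon> \<le> 1"
    and "\<gamma> = (\<delta> * (real k - 1) + (1 - \<delta>) * (real k + 1)) /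
             (\<epsilon> * (real k - 1) + (1 - \<epsilon>) * (real k + 1))"
  shows "\<gamma> > 1 \<and>
    (\<exists>f :: formula \<Rightarrow> cvp_desc.
       poly_time_on (ksat_formulas k) enc_formula enc_cvp f \<and>
       (\<forall>\<Phi> \<in> ksat_formulas k.
          wf_cvp_desc (generators \<delta> \<epsilon>) (f \<Phi>) \<and>
          cvp_of (generators \<delta> \<epsilon>) (f \<Phi>) \<in> cvp_instances (num_vars \<Phi>)) \<and>
       (\<forall>\<Phi> \<in> gap_ksat_yes k \<epsilon>. cvp_of (generators \<delta> \<epsilon>) (f \<Phi>) \<in> cvp1_yes) \<and>
       (\<forall>\<Phi> \<in> gap_ksat_no k \<delta>. cvp_of (generators \<delta> \<epsilon>) (f \<Phi>) \<in> cvp1_no \<gamma>))"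
proof
  have pos: "real k + 1 - 2 * \<epsilon> > 0" using assms(1,4) by simp
  \<comment> \<open>Both weighted averages of \<open>k - 1\<close> and \<open>k + 1\<close> are
    linear in their parameter with slope -2.\<close>
  have \<gamma>: "\<gamma> = (real k + 1 - 2 * \<delta>) / (real k + 1 - 2 * \<epsilon>)"
    unfolding assms(5) by (simp add: algebra_simps)
  then show "\<gamma> > 1" using pos assms(3) by simp
  have eq: "\<gamma> * (real k + 1 - 2 * \<epsilon>) = real k + 1 - 2 * \<delta>" using \<gamma> pos by simp
  obtain num rad w0 ws W \<alpha> where "gap_reduction k num rad w0 ws W (generators \<delta> \<epsilon>) \<alpha> \<epsilon>"
  proof (cases "\<delta> \<in> \<rat> \<and> \<epsilon> \<in> \<rat>")
    case True
    then show ?thesis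
      using gap_reduction_rational[OF assms(1,4)] that by (simp add: generators_def) blast
  next
    case False
    then have "generators \<delta> \<epsilon> = [1, \<delta>, \<epsilon>]" by (simp add: generators_def)
    then show ?thesis using gap_reduction_general[OF assms(1,4)] that by metis
  qed
  then show "\<exists>f :: formula \<Rightarrow> cvp_desc.
       poly_time_on (ksat_formulas k) enc_formula enc_cvp f \<and>
       (\<forall>\<Phi> \<in> ksat_formulas k.
          wf_cvp_desc (generators \<delta> \<epsilon>) (f \<Phi>) \<and>
          cvp_of (generators \<delta> \<epsilon>) (f \<Phi>) \<in> cvp_instances (num_vars \<Phi>)) \<and>
       (\<forall>\<Phi> \<in> gap_ksat_yes k \<epsilon>. cvp_of (generators \<delta> \<epsilon>) (f \<Phi>) \<in> cvp1_yes) \<and>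
       (\<forall>\<Phi> \<in> gap_ksat_no k \<delta>. cvp_of (generators \<delta> \<epsilon>) (f \<Phi>) \<in> cvp1_no \<gamma>)"
    using eq by (rule gap_reduction.reduction)
qed

end
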